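(* Let $\lambda$ be a frequency. For each $\ell\ge 0$ the space $H_{\infty,\ell}^{\lambda}[\mathrm{Re}>0]$ together with the norm $\|\cdot\|_{\infty,\ell}$ forms a Banach space.
   Context: A frequency is a strictly increasing sequence $\lambda=(\lambda_n)_{n\ge 1}$ of non-negative real numbers with $\lambda_n\to\infty$. A $\lambda$-Dirichlet series is a formal series $D=\sum a_n e^{-\lambda_n s}$ with complex coefficients $a_n$. Write $[\mathrm{Re}>\sigma]=\{s\in\mathbb{C}:\mathrm{Re}\,s>\sigma\}$. A $\lambda$-Dirichlet series $D=\sum a_ne^{-\lambda_ns}$ is a $\lambda$-Riesz germ of a holomorphic function $f:[\mathrm{Re}>0]\to\mathbb{C}$ if for some $m\ge 0$ and some $\sigma\ge 0$ one has $f(s)=\lim_{x\to\infty}\sum_{\lambda_n<x}a_ne^{-\lambda_ns}\big(1-\frac{\lambda_n}{x}\big)^m$ for all $s\in[\mathrm{Re}>\sigma]$. For $\ell\ge 0$, $H_{\infty,\ell}^{\lambda}[\mathrm{Re}>0]$ is the complex linear space of all holomorphic $f:[\mathrm{Re}>0]\to\mathbb{C}$ which have a $\lambda$-Riesz germ and satisfy $\|f\|_{\infty,\ell}=\sup_{\mathrm{Re}\,s>0}\frac{|f(s)|}{(1+|s|)^{\ell}}<\infty$. *)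

theory Defs
  imports "HOL-Complex_Analysis.Complex_Analysis" "HOL-Library.Function_Algebras"
begin

(* Complex normed and Banach spaces carried by a linear subspace V of an ambient
   complex vector space. *)

locale complex_normed_space_on = vector_space scale
  for scale :: "complex \<Rightarrow> 'a::ab_group_add \<Rightarrow> 'a" +
  fixes V :: "'a set" and N :: "'a \<Rightarrow> real"
  assumes subspace_V: "module.subspace scale V"
    and N_nonneg: "f \<in> V \<Longrightarrow> 0 \<le> N f"
    and N_eq_0_iff: "f \<in> V \<Longrightarrow> N f = 0 \<longleftrightarrow> f = 0"
    and N_scale: "f \<in> V \<Longrightarrow> N (scale c f) = cmod c * N f"
    and N_triangle: "f \<in> V \<Longrightarrow> g \<in> V \<Longrightarrow> N (f + g) \<le> N f + N g"
begin

lemma diff_in_V: "f \<in> V \<Longrightarrow> g \<in> V \<Longrightarrow> f - g \<in> V"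
  by (rule subspace_diff[OF subspace_V])

lemma N_minus_commute:
  assumes "f \<in> V" "g \<in> V"
  shows "N (f - g) = N (g - f)"
proof -
  have "f - g = scale (-1) (g - f)"
    by simp
  then show ?thesis
    using N_scale[OF diff_in_V[OF assms(2,1)], of "-1"] by simp
qed

definition norm_dist :: "'a \<Rightarrow> 'a \<Rightarrow> real" where
  "norm_dist f g = (if f \<in> V \<and> g \<in> V then N (f - g) else 0)"

(* The locale Metric_space requires nonnegativity and symmetry of the distance on
   the whole type, whence the case distinction in norm_dist. *)
sublocale norm_metric: Metric_space V norm_dist
proof
  show "0 \<le> norm_dist f g" for f g
    by (simp add: norm_dist_def N_nonneg diff_in_V)
  show "norm_dist f g = norm_dist g f" for f g
    by (simp add: norm_dist_def N_minus_commute)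
  show "norm_dist f g = 0 \<longleftrightarrow> f = g" if "f \<in> V" "g \<in> V" for f g
    using that by (simp add: norm_dist_def N_eq_0_iff diff_in_V)
  show "norm_dist f h \<le> norm_dist f g + norm_dist g h"
    if "f \<in> V" "g \<in> V" "h \<in> V" for f g h
    using that N_triangle[of "f - g" "g - h"] by (simp add: norm_dist_def diff_in_V)
qed

end

locale complex_banach_space_on = complex_normed_space_on +
  assumes complete: "norm_metric.mcomplete"

definition frequency :: "(nat \<Rightarrow> real) \<Rightarrow> bool" where
  "frequency lam \<longleftrightarrow> strict_mono lam \<and> (\<forall>n. 0 \<le> lam n) \<and> filterlim lam at_top sequentially"

definition right_half_plane :: "real \<Rightarrow> complex set" where
  "right_half_plane \<sigma> = {s. \<sigma> < Re s}"

(* A Dirichlet series is formal, hence given by its coefficient sequence a; indices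
   start at 0. *)
definition riesz_mean ::
    "(nat \<Rightarrow> real) \<Rightarrow> (nat \<Rightarrow> complex) \<Rightarrow> real \<Rightarrow> real \<Rightarrow> complex \<Rightarrow> complex" where
  "riesz_mean lam a m x s =
     (\<Sum>n | lam n < x. a n * exp (- of_real (lam n) * s) * of_real ((1 - lam n / x) powr m))"

definition riesz_germ ::
    "(nat \<Rightarrow> real) \<Rightarrow> (nat \<Rightarrow> complex) \<Rightarrow> (complex \<Rightarrow> complex) \<Rightarrow> bool" where
  "riesz_germ lam a f \<longleftrightarrow>
     (\<exists>m\<ge>0. \<exists>\<sigma>\<ge>0. \<forall>s\<in>right_half_plane \<sigma>. ((\<lambda>x. riesz_mean lam a m x s) \<longlongrightarrow> f s) at_top)"

definition Hinf_norm :: "real \<Rightarrow> (complex \<Rightarrow> complex) \<Rightarrow> real" where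
  "Hinf_norm l f = (SUP s\<in>right_half_plane 0. cmod (f s) / (1 + cmod s) powr l)"

(* A function on [Re > 0] is represented by its extension by 0 to the whole plane, so
   that equality of representatives is equality on [Re > 0]. *)
definition Hinf :: "(nat \<Rightarrow> real) \<Rightarrow> real \<Rightarrow> (complex \<Rightarrow> complex) set" where
  "Hinf lam l = {f. f holomorphic_on right_half_plane 0
      \<and> (\<forall>s. s \<notin> right_half_plane 0 \<longrightarrow> f s = 0)
      \<and> (\<exists>a. riesz_germ lam a f)
      \<and> bdd_above ((\<lambda>s. cmod (f s) / (1 + cmod s) powr l) ` right_half_plane 0)}"

definition fun_scale :: "complex \<Rightarrow> (complex \<Rightarrow> complex) \<Rightarrow> complex \<Rightarrow> complex" where
  "fun_scale c f = (\<lambda>s. c * f s)"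

end

theory Submission
  imports Defs "HOL-Probability.Sinc_Integral" "HOL-Real_Asymp.Real_Asymp"
begin

text \<open>Let \<open>N\<close> be an integer with \<open>N \<ge> l\<close> and let \<open>f\<close> have growth at most \<open>(1 + \<bar>s\<bar>) ^ N\<close> and a germ with
  coefficients \<open>a\<close>. Perron's formula
  \<open>C * (\<Sum>n | lam n < y. a n * (y - lam n) ^ (N + 1)) = \<integral> f s * exp (y * s) / s ^ (N + 2)\<close> over \<open>Re s = c\<close>,
  \<open>c > 0\<close>, is obtained first for large \<open>c\<close> and large order as a limit of the trivial formula for
  the Riesz means, which grow at most polynomially by summation by parts; the order is then lowered by
  differentiating in \<open>y\<close>, and \<open>c\<close> is moved by Cauchy's theorem. Consequently the coefficients depend
  continuously on \<open>f\<close> in the norm, so that Perron's formula passes to the limit of a Cauchy sequence.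
  Conversely, Perron's formula for all the functions \<open>f (s + w)\<close>, taken on the line \<open>Re s = 1 / y\<close>, implies
  that the Riesz means of order \<open>N + 1\<close> converge to \<open>f\<close> on the half plane: hence the limit has a germ, and
  the sum of two functions does too. Of the constant \<open>C\<close> one only needs that it does not vanish.\<close>

subsection \<open>Integrals along vertical lines\<close>

text \<open>The obstacle is that every germ brings its own order \<open>m\<close> and its own
  abscissa \<open>\<sigma>\<close>, and along a Cauchy sequence the norm controls neither. Perron's
  formula of order \<open>N + 2\<close> with \<open>N = nat \<lceil>l\<rceil>\<close> is a form of
  the germ in which both have disappeared, so it survives the limit. Translation by \<open>w\<close>
  only twists \<open>a n\<close> by \<open>exp (- lam n * w)\<close> and keeps the growth exponent,
  so a single kernel with its pole at \<open>0\<close> serves every point of the half plane. On the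
  line of abscissa \<open>1 / y\<close> the factor \<open>exp (y * s)\<close> has the fixed modulus
  \<open>exp 1\<close>, and after rescaling the argument of \<open>f\<close> tends to
  \<open>w\<close>; this is what reduces the return from Perron's formula to dominated convergence.
  The constant of order \<open>p\<close> is \<open>2 * \<pi> / (p - 1)!\<close>, as the integrals
  run over \<open>t = Im s\<close> without the factor \<open>1 / (2 * \<pi>)\<close>. It is not
  evaluated: a positive integral handles \<open>p = 2\<close>, and differentiation links order
  \<open>p\<close> to order \<open>p + 1\<close>. Derivatives in \<open>y\<close> are left
  difference quotients, because the condition \<open>lam n < y\<close> is stable under small
  decreases of \<open>y\<close> even when \<open>y\<close> is itself a frequency.\<close>

lemma integrable_Cauchy_density: "integrable lborel (\<lambda>t::real. B / (1 + t\<^sup>2))"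
proof -
  have "integrable lborel (\<lambda>t::real. inverse (1 + t\<^sup>2))"
    using integrable_inverse_1_plus_square by (simp add: set_integrable_def)
  then show ?thesis
    by (simp add: divide_inverse)
qed

lemma measurable_vertical_line:
  assumes "G holomorphic_on {s. a < Re s}" "a < c"
  shows "(\<lambda>t. G (Complex c t)) \<in> borel_measurable lborel"
proof -
  have "continuous_on UNIV (\<lambda>t. G (Complex c t))"
    by (rule continuous_on_compose2[OF holomorphic_on_imp_continuous_on[OF assms(1)]])
       (use assms(2) in \<open>auto simp: Complex_eq intro!: continuous_intros\<close>)
  then show ?thesis
    by (simp add: borel_measurable_continuous_onI)
qed

lemma integrable_vertical_line:
  assumes "G holomorphic_on {s. a < Re s}" "a < c"
    and "\<And>t. cmod (G (Complex c t)) \<le> B / (1 + t\<^sup>2)"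
  shows "integrable lborel (\<lambda>t. G (Complex c t))"
  by (rule Bochner_Integration.integrable_bound[OF integrable_Cauchy_density[of B]
        measurable_vertical_line[OF assms(1,2)]])
     (intro always_eventually allI order_trans[OF assms(3)], simp only: real_norm_def abs_ge_self)

lemma vertical_line_truncation:
  assumes "G holomorphic_on {s. a < Re s}" "a < c"
    and bound: "\<And>t. cmod (G (Complex c t)) \<le> B / (1 + t\<^sup>2)"
  shows "(\<lambda>n. LINT t|lborel. indicator {-real n..real n} t *\<^sub>R G (Complex c t))
           \<longlonglongrightarrow> (LINT t|lborel. G (Complex c t))"
proof (rule integral_dominated_convergence[where w = "\<lambda>t. B / (1 + t\<^sup>2)"])
  note [measurable] = measurable_vertical_line[OF assms(1,2)]
  show "(\<lambda>t. G (Complex c t)) \<in> borel_measurable lborel" by measurable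
  show "(\<lambda>t. indicator {-real n..real n} t *\<^sub>R G (Complex c t)) \<in> borel_measurable lborel" for n
    by measurable
  show "AE t in lborel. (\<lambda>n. indicator {-real n..real n} t *\<^sub>R G (Complex c t)) \<longlonglongrightarrow> G (Complex c t)"
  proof (rule AE_I2, rule tendsto_eventually)
    fix t :: real
    obtain n0 where "\<bar>t\<bar> \<le> real n0" using real_arch_simple by blast
    then have "indicator {-real n..real n} t *\<^sub>R G (Complex c t) = G (Complex c t)" if "n \<ge> n0" for n
    proof -
      have "\<bar>t\<bar> \<le> real n"
        using \<open>\<bar>t\<bar> \<le> real n0\<close> that by linarith
      then have "t \<in> {-real n..real n}" by (simp add: abs_le_iff)
      then show ?thesis by simp
    qed
    then show "\<forall>\<^sub>F n in sequentially. indicator {-real n..real n} t *\<^sub>R G (Complex c t) = G (Complex c t)"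
      by (auto simp: eventually_sequentially)
  qed
  have "0 \<le> B / (1 + t\<^sup>2)" for t
    using bound[of t] norm_ge_zero order_trans by blast
  then show "AE t in lborel. norm (indicator {-real n..real n} t *\<^sub>R G (Complex c t)) \<le> B / (1 + t\<^sup>2)" for n
    using bound by (intro always_eventually allI) (auto simp: indicator_def)
qed (rule integrable_Cauchy_density)

text \<open>Cauchy's theorem by means of a primitive \<open>\<Phi>\<close>: a truncated vertical
  integral is a difference of two values of \<open>\<Phi>\<close>, so two of them differ by
  increments of \<open>\<Phi>\<close> along the horizontal sides at heights \<open>n\<close> and
  \<open>-n\<close>. Each increment is at most \<open>B / (1 + n\<^sup>2) * (d - c)\<close> and
  vanishes in the limit.\<close>

lemma vertical_line_shift_le:
  assumes hol: "G holomorphic_on {s. a < Re s}" and "a < c" "c \<le> d"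
    and bound: "\<And>s. c \<le> Re s \<Longrightarrow> Re s \<le> d \<Longrightarrow> cmod (G s) \<le> B / (1 + (Im s)\<^sup>2)"
  shows "(LINT t|lborel. G (Complex c t)) = (LINT t|lborel. G (Complex d t))"
proof -
  let ?S = "{s. a < Re s}"
  have S: "convex ?S" "open ?S"
    by (auto simp: convex_halfspace_Re_gt open_halfspace_Re_gt)
  obtain \<Phi> where "\<And>s. s \<in> ?S \<Longrightarrow> (\<Phi> has_field_derivative G s) (at s within ?S)"
    using holomorphic_convex_primitive'[OF S hol] by blast
  then have \<Phi>: "(\<Phi> has_field_derivative G s) (at s)" if "a < Re s" for s
    using at_within_open[OF _ S(2)] that by force
  define I where "I e n = (LINT t|lborel. indicator {-real n..real n} t *\<^sub>R G (Complex e t))" for e n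
  \<comment> \<open>The parametrisation \<open>s = e + \<i> * t\<close> has
    \<open>ds = \<i> dt\<close>, whence the division by \<open>\<i>\<close>.\<close>
  have I: "I e n = (\<Phi> (Complex e (real n)) - \<Phi> (Complex e (- real n))) / \<i>" if "a < e" for e n
  proof -
    have "I e n = \<Phi> (Complex e (real n)) / \<i> - \<Phi> (Complex e (- real n)) / \<i>"
      unfolding I_def
    proof (rule integral_FTC_atLeastAtMost)
      show "continuous_on {- real n..real n} (\<lambda>t. G (Complex e t))"
        by (rule continuous_on_compose2[OF holomorphic_on_imp_continuous_on[OF hol]])
           (use that in \<open>auto simp: Complex_eq intro!: continuous_intros\<close>)
      fix t
      have 1: "(\<Phi> has_field_derivative G (of_real e + \<i> * of_real t)) (at (of_real e + \<i> * of_real t))"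
        by (rule \<Phi>) (use that in simp)
      have 2: "((\<lambda>z. of_real e + \<i> * z) has_field_derivative \<i>) (at (of_real t))"
        by (auto intro!: derivative_eq_intros)
      have "((\<lambda>z. \<Phi> (of_real e + \<i> * z) / \<i>) has_field_derivative G (of_real e + \<i> * of_real t)) (at (of_real t))"
        by (rule DERIV_cong[OF DERIV_cdivide[OF DERIV_chain2[OF 1 2], of \<i>]])
           (rule nonzero_mult_div_cancel_right[OF complex_i_not_zero])
      then show "((\<lambda>t. \<Phi> (Complex e t) / \<i>) has_vector_derivative G (Complex e t)) (at t within {- real n..real n})"
        unfolding Complex_eq by (rule has_vector_derivative_real_field)
    qed simp
    then show ?thesis by (simp only: diff_divide_distrib)
  qed
  have close: "cmod (\<Phi> (Complex c t) - \<Phi> (Complex d t)) \<le> B / (1 + t\<^sup>2) * (d - c)" for t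
  proof -
    let ?L = "closed_segment (Complex c t) (Complex d t)"
    have L: "Im s = t" "c \<le> Re s" "Re s \<le> d" if "s \<in> ?L" for s
    proof -
      obtain u where u: "0 \<le> u" "u \<le> 1" "s = (1 - u) *\<^sub>R Complex c t + u *\<^sub>R Complex d t"
        using \<open>s \<in> ?L\<close> by (auto simp: in_segment)
      show "Im s = t" unfolding u(3) by (simp add: algebra_simps)
      have "Re s = c + u * (d - c)" unfolding u(3) by (simp add: algebra_simps)
      moreover have "0 \<le> u * (d - c)" "u * (d - c) \<le> d - c"
        using u \<open>c \<le> d\<close> by (auto intro!: mult_left_le_one_le)
      ultimately show "c \<le> Re s" "Re s \<le> d" by auto
    qed
    have "cmod (\<Phi> (Complex c t) - \<Phi> (Complex d t)) \<le> B / (1 + t\<^sup>2) * norm (Complex c t - Complex d t)"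
    proof (rule field_differentiable_bound)
      show "(\<Phi> has_field_derivative G s) (at s within ?L)" if "s \<in> ?L" for s
        using \<Phi>[of s] L[OF that] \<open>a < c\<close> by (auto intro: has_field_derivative_at_within)
      show "cmod (G s) \<le> B / (1 + t\<^sup>2)" if "s \<in> ?L" for s
        using bound[of s] L[OF that] by simp
    qed auto
    also have "Complex c t - Complex d t = of_real (c - d)"
      by (simp add: complex_eq_iff)
    also have "norm (of_real (c - d) :: complex) = d - c"
      using \<open>c \<le> d\<close> by (simp del: of_real_diff)
    finally show ?thesis .
  qed
  have lim: "(\<lambda>n. I e n) \<longlonglongrightarrow> (LINT t|lborel. G (Complex e t))" if "c \<le> e" "e \<le> d" for e
    unfolding I_def using that \<open>a < c\<close> bound[of "Complex e _"]
    by (intro vertical_line_truncation[OF hol, of e B]) auto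
  have "(\<lambda>n. I c n - I d n) \<longlonglongrightarrow> 0"
  proof (rule Lim_null_comparison)
    show "\<forall>\<^sub>F n in sequentially. norm (I c n - I d n) \<le> 2 * (B / (1 + (real n)\<^sup>2) * (d - c))"
    proof (intro always_eventually allI)
      fix n
      have "I c n - I d n = ((\<Phi> (Complex c n) - \<Phi> (Complex d n))
          - (\<Phi> (Complex c (-n)) - \<Phi> (Complex d (-n)))) / \<i>"
        using \<open>a < c\<close> \<open>c \<le> d\<close> by (simp add: I algebra_simps)
      also have "norm \<dots> \<le> cmod (\<Phi> (Complex c n) - \<Phi> (Complex d n))
          + cmod (\<Phi> (Complex c (-n)) - \<Phi> (Complex d (-n)))"
        by (simp add: norm_divide norm_mult norm_triangle_ineq4)
      also have "\<dots> \<le> 2 * (B / (1 + (real n)\<^sup>2) * (d - c))"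
        using close[of n] close[of "-n"] by simp
      finally show "norm (I c n - I d n) \<le> 2 * (B / (1 + (real n)\<^sup>2) * (d - c))" .
    qed
    show "(\<lambda>n. 2 * (B / (1 + (real n)\<^sup>2) * (d - c))) \<longlonglongrightarrow> 0"
      by real_asymp
  qed
  moreover have "(\<lambda>n. I c n - I d n) \<longlonglongrightarrow> (LINT t|lborel. G (Complex c t)) - (LINT t|lborel. G (Complex d t))"
    using lim \<open>c \<le> d\<close> by (intro tendsto_diff) auto
  ultimately show ?thesis
    using LIMSEQ_unique by fastforce
qed

subsection \<open>Bromwich integrals\<close>

text \<open>Up to the factor \<open>1 / (2 * \<pi>)\<close> this is the inverse Laplace integral of
  \<open>g s / s ^ p\<close> at \<open>y\<close>, taken along \<open>Re s = c\<close>.\<close>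

definition bromwich :: "nat \<Rightarrow> (complex \<Rightarrow> complex) \<Rightarrow> real \<Rightarrow> real \<Rightarrow> complex" where
  "bromwich p g y c =
     (LINT t|lborel. g (Complex c t) * exp (of_real y * Complex c t) / Complex c t ^ p)"

text \<open>Since \<open>cmod s \<ge> c\<close>, one has
  \<open>1 + cmod s \<le> (1 + 1 / c) * cmod s\<close>. Hence \<open>p\<close> powers of
  \<open>s\<close> absorb the \<open>N\<close> powers of growth and two more, which leave the
  integrable density \<open>1 / (1 + (Im s)\<^sup>2)\<close>.\<close>

lemma bromwich_kernel_bound:
  assumes "0 < c" "c \<le> Re s" "N + 2 \<le> p" "cmod (g s) \<le> B * (1 + cmod s) ^ N"
  shows "cmod (g s * exp (of_real y * s) / s ^ p) \<le> B * (1 + 1 / c) ^ p * exp (y * Re s) / (1 + (Im s)\<^sup>2)"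
proof -
  define r where "r = cmod s"
  have r: "c \<le> r" "0 < r"
    using assms complex_Re_le_cmod[of s] by (auto simp: r_def)
  have "0 \<le> B * (1 + r) ^ N"
    using assms(4) norm_ge_zero[of "g s"] unfolding r_def by linarith
  moreover have "0 < (1 + r) ^ N"
    using r by simp
  ultimately have B: "0 \<le> B"
    by (simp add: zero_le_mult_iff)
  have "1 + (Im s)\<^sup>2 \<le> (1 + r)\<^sup>2"
    using r abs_Im_le_cmod[of s] abs_le_square_iff[of "Im s" r]
    by (simp add: r_def power2_sum)
  then have "(1 + r) ^ N * (1 + (Im s)\<^sup>2) \<le> (1 + r) ^ N * (1 + r)\<^sup>2"
    using r by (intro mult_left_mono) auto
  also have "\<dots> \<le> (1 + r) ^ p"
    unfolding power_add[symmetric] using r assms(3) by (intro power_increasing) auto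
  also have "\<dots> \<le> ((1 + 1 / c) * r) ^ p"
  proof (rule power_mono)
    have "c / c \<le> r / c"
      using r assms(1) by (intro divide_right_mono) auto
    then show "1 + r \<le> (1 + 1 / c) * r"
      using assms(1) by (simp add: algebra_simps)
  qed (use r in auto)
  finally have *: "(1 + r) ^ N * (1 + (Im s)\<^sup>2) \<le> (1 + 1 / c) ^ p * r ^ p"
    by (simp add: power_mult_distrib)
  have "cmod (g s) * (1 + (Im s)\<^sup>2) \<le> B * (1 + r) ^ N * (1 + (Im s)\<^sup>2)"
    using assms(4) by (intro mult_right_mono) (auto simp: r_def)
  also have "\<dots> \<le> B * ((1 + 1 / c) ^ p * r ^ p)"
    using mult_left_mono[OF * B] by (simp add: mult.assoc)
  finally have "cmod (g s) / r ^ p \<le> B * (1 + 1 / c) ^ p / (1 + (Im s)\<^sup>2)"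
    using r by (simp add: field_simps add_pos_nonneg)
  then have "cmod (g s) / r ^ p * exp (y * Re s) \<le> B * (1 + 1 / c) ^ p / (1 + (Im s)\<^sup>2) * exp (y * Re s)"
    by (intro mult_right_mono) auto
  then show ?thesis
    by (simp add: norm_mult norm_divide norm_power r_def)
qed

lemma bromwich_integrand_holomorphic:
  assumes "g holomorphic_on {s. a < Re s}" "0 \<le> a"
  shows "(\<lambda>s. g s * exp (of_real y * s) / s ^ p) holomorphic_on {s. a < Re s}"
  using assms by (auto intro!: holomorphic_intros)

lemma bromwich_integrand_measurable:
  assumes "g holomorphic_on {s. a < Re s}" "0 \<le> a" "a < c"
  shows "(\<lambda>t. g (Complex c t) * exp (of_real y * Complex c t) / Complex c t ^ p) \<in> borel_measurable lborel"
  using measurable_vertical_line[OF bromwich_integrand_holomorphic[OF assms(1,2)] assms(3)] .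

lemma bromwich_integrable:
  assumes "g holomorphic_on {s. a < Re s}" "0 \<le> a" "a < c" "N + 2 \<le> p"
    and "\<And>t. cmod (g (Complex c t)) \<le> B * (1 + cmod (Complex c t)) ^ N"
  shows "integrable lborel (\<lambda>t. g (Complex c t) * exp (of_real y * Complex c t) / Complex c t ^ p)"
  by (rule integrable_vertical_line[OF bromwich_integrand_holomorphic[OF assms(1,2)] assms(3),
        where B = "B * (1 + 1 / c) ^ p * exp (y * c)"])
     (use assms bromwich_kernel_bound[of c "Complex c _" N p g B y] in auto)

lemma bromwich_shift:
  assumes hol: "g holomorphic_on {s. a < Re s}" "0 \<le> a" and "a < c" "a < d" and p: "N + 2 \<le> p"
    and bound: "\<And>s. a < Re s \<Longrightarrow> cmod (g s) \<le> B * (1 + cmod s) ^ N"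
  shows "bromwich p g y c = bromwich p g y d"
proof -
  have *: "bromwich p g y c = bromwich p g y d" if "a < c" "c \<le> d" for c d
  proof -
    \<comment> \<open>The bound has to be uniform over the strip: \<open>1 + 1 / c\<close> is
      largest at the left edge, and \<open>\<bar>y\<bar> * d\<close> dominates
      \<open>y * Re s\<close> for either sign of \<open>y\<close>.\<close>
    define B' where "B' = B * (1 + 1 / c) ^ p * exp (\<bar>y\<bar> * d)"
    have "cmod (g (Complex c 0)) \<le> B * (1 + cmod (Complex c 0)) ^ N"
      using bound[of "Complex c 0"] \<open>a < c\<close> by simp
    then have "0 \<le> B * (1 + cmod (Complex c 0)) ^ N"
      using norm_ge_zero order_trans by blast
    moreover have "0 < (1 + cmod (Complex c 0)) ^ N"
      by (simp add: add_pos_nonneg)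
    ultimately have "0 \<le> B"
      by (simp add: zero_le_mult_iff)
    have "cmod (g s * exp (of_real y * s) / s ^ p) \<le> B' / (1 + (Im s)\<^sup>2)"
      if s: "c \<le> Re s" "Re s \<le> d" for s
    proof -
      have "0 < c" "0 \<le> Re s" using \<open>a < c\<close> \<open>0 \<le> a\<close> s by linarith+
      have "y * Re s \<le> \<bar>y\<bar> * Re s"
        by (rule mult_right_mono) (use \<open>0 \<le> Re s\<close> in auto)
      also have "\<dots> \<le> \<bar>y\<bar> * d"
        by (rule mult_left_mono) (use s in auto)
      finally have "exp (y * Re s) \<le> exp (\<bar>y\<bar> * d)" by simp
      then have "B * (1 + 1 / c) ^ p * exp (y * Re s) \<le> B'"
        unfolding B'_def using \<open>0 \<le> B\<close> \<open>0 < c\<close> by (intro mult_left_mono) auto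
      then have "B * (1 + 1 / c) ^ p * exp (y * Re s) / (1 + (Im s)\<^sup>2) \<le> B' / (1 + (Im s)\<^sup>2)"
        by (rule divide_right_mono) simp
      moreover have "cmod (g s) \<le> B * (1 + cmod s) ^ N"
        by (rule bound) (use s \<open>a < c\<close> in linarith)
      ultimately show ?thesis
        using bromwich_kernel_bound[OF \<open>0 < c\<close> s(1) p, of g B y] by (meson order_trans)
    qed
    then show ?thesis
      unfolding bromwich_def
      by (rule vertical_line_shift_le[OF bromwich_integrand_holomorphic[OF hol, of y p] \<open>a < c\<close> \<open>c \<le> d\<close>])
  qed
  show ?thesis
    using *[OF \<open>a < c\<close>, of d] *[OF \<open>a < d\<close>, of c] by (metis linear)
qed

text \<open>Substituting \<open>s / u\<close> for \<open>s\<close> maps the line of abscissa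
  \<open>1\<close> onto that of abscissa \<open>1 / u\<close>; the power of \<open>s\<close>
  releases \<open>u ^ p\<close>, and the differential takes back one factor
  \<open>u\<close>.\<close>

lemma bromwich_rescale:
  assumes "0 < u" "1 \<le> p"
  shows "bromwich p g u (1 / u) = of_real u ^ (p - 1) * bromwich p (\<lambda>s. g (s / of_real u)) 1 1"
proof -
  have s: "Complex (1 / u) (t / u) = Complex 1 t / of_real u" for t
    using assms by (simp add: complex_eq_iff)
  have "bromwich p g u (1 / u) = of_real (1 / u) *
      (LINT t|lborel. g (Complex (1 / u) (t / u)) * exp (of_real u * Complex (1 / u) (t / u)) / Complex (1 / u) (t / u) ^ p)"
    unfolding bromwich_def using assms
    by (subst lborel_integral_real_affine[of "1 / u" _ 0]) (auto simp: scaleR_conv_of_real)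
  also have "\<dots> = of_real (1 / u) * (LINT t|lborel. of_real u ^ p *
      (g (Complex 1 t / of_real u) * exp (of_real 1 * Complex 1 t) / Complex 1 t ^ p))"
    unfolding s using assms by (simp add: power_divide mult_ac)
  also have "\<dots> = of_real (1 / u) * of_real u ^ p * bromwich p (\<lambda>s. g (s / of_real u)) 1 1"
    unfolding bromwich_def by (simp only: integral_mult_right_zero mult.assoc)
  also have "of_real (1 / u) * of_real u ^ p = (of_real u ^ (p - 1) :: complex)"
    using assms by (cases p) auto
  finally show ?thesis .
qed

section \<open>The Perron integral of the constant function 1\<close>

lemma bromwich_one_pos:
  assumes "2 \<le> p" "0 < u" "0 < c"
  shows "bromwich p (\<lambda>_. 1) u c = of_real u ^ (p - 1) * bromwich p (\<lambda>_. 1) 1 1"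
proof -
  \<comment> \<open>The abscissa is free, so it is moved to \<open>1 / u\<close>, where
    \<open>bromwich_rescale\<close> applies.\<close>
  have "bromwich p (\<lambda>_. 1) u c = bromwich p (\<lambda>_. 1) u (1 / u)"
    by (rule bromwich_shift[where a = 0 and N = 0 and B = 1]) (use assms in auto)
  then show ?thesis
    using bromwich_rescale[of u p "\<lambda>_. 1"] assms by simp
qed

text \<open>For \<open>u \<le> 0\<close> the exponential stays bounded when the line moves to the
  right, while \<open>1 / s ^ p\<close> tends to \<open>0\<close>. The integrals over the abscissae
  \<open>n + 1\<close> all agree with the given one, and they tend to \<open>0\<close>. This
  vanishing is what cuts the sum in Perron's formula off at \<open>lam n < y\<close>.\<close>

lemma bromwich_one_nonpos:
  assumes "2 \<le> p" "u \<le> 0" "0 < c"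
  shows "bromwich p (\<lambda>_. 1) u c = 0"
proof -
  let ?F = "\<lambda>n t. 1 * exp (of_real u * Complex (real (Suc n)) t) / Complex (real (Suc n)) t ^ p"
  have "(\<lambda>n. LINT t|lborel. ?F n t) \<longlonglongrightarrow> (LINT t::real|lborel. (0::complex))"
  proof (rule integral_dominated_convergence[where w = "\<lambda>t. 2 ^ p / (1 + t\<^sup>2)"])
    show "?F n \<in> borel_measurable lborel" for n
      by (rule bromwich_integrand_measurable[where a = 0 and g = "\<lambda>_. 1"]) auto
    show "AE t in lborel. norm (?F n t) \<le> 2 ^ p / (1 + t\<^sup>2)" for n
    proof (rule AE_I2)
      fix t :: real
      have "norm (?F n t) \<le> 1 * (1 + 1 / 1) ^ p * exp (u * Re (Complex (real (Suc n)) t)) / (1 + (Im (Complex (real (Suc n)) t))\<^sup>2)"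
        by (rule bromwich_kernel_bound[where N = 0 and g = "\<lambda>_. 1"]) (use assms in auto)
      also have "\<dots> \<le> 2 ^ p / (1 + t\<^sup>2)"
      proof -
        have "u * real (Suc n) \<le> 0"
          using assms by (intro mult_nonpos_nonneg) auto
        then have "2 ^ p * exp (u * real (Suc n)) \<le> 2 ^ p * 1"
          by (intro mult_left_mono) auto
        from divide_right_mono[OF this, of "1 + t\<^sup>2"] show ?thesis by simp
      qed
      finally show "norm (?F n t) \<le> 2 ^ p / (1 + t\<^sup>2)" .
    qed
    show "AE t in lborel. (\<lambda>n. ?F n t) \<longlonglongrightarrow> 0"
    proof (rule AE_I2, rule Lim_null_comparison[where g = "\<lambda>n. 1 / real (Suc n)"], rule always_eventually, rule allI)
      fix t :: real and n
      have r: "real (Suc n) \<le> cmod (Complex (real (Suc n)) t)"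
        using complex_Re_le_cmod[of "Complex (real (Suc n)) t"] by simp
      have "real (Suc n) * 1 \<le> real (Suc n) * real (Suc n) ^ (p - 1)"
        by (intro mult_left_mono) auto
      also have "\<dots> = real (Suc n) ^ p"
        using assms(1) by (cases p) auto
      also have "\<dots> \<le> cmod (Complex (real (Suc n)) t) ^ p"
        using r by (intro power_mono) auto
      finally have "exp (u * real (Suc n)) / cmod (Complex (real (Suc n)) t) ^ p \<le> 1 / real (Suc n)"
        using assms by (intro frac_le) (auto intro!: mult_nonpos_nonneg)
      then show "norm (?F n t) \<le> 1 / real (Suc n)"
        by (simp add: norm_divide norm_power)
    next
      show "(\<lambda>n. 1 / real (Suc n)) \<longlonglongrightarrow> 0"
        by real_asymp
    qed
  qed (auto intro: integrable_Cauchy_density)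
  moreover have "(LINT t|lborel. ?F n t) = bromwich p (\<lambda>_. 1) u c" for n
    unfolding bromwich_def
    by (rule bromwich_shift[where a = 0 and N = 0 and B = 1 and g = "\<lambda>_. 1", unfolded bromwich_def]) (use assms in auto)
  ultimately show ?thesis
    by (simp add: LIMSEQ_const_iff)
qed

section \<open>Differentiation in \<open>y\<close> and the non-vanishing of the constant\<close>

lemma cmod_exp_minus_one_le: "cmod (exp z - 1) \<le> cmod z * exp \<bar>Re z\<bar>"
proof -
  let ?L = "closed_segment 0 z"
  have "cmod (exp z - exp 0) \<le> exp \<bar>Re z\<bar> * cmod (z - 0)"
  proof (rule field_differentiable_bound[of ?L])
    show "cmod (exp w) \<le> exp \<bar>Re z\<bar>" if w: "w \<in> ?L" for w
    proof -
      obtain u where u: "0 \<le> u" "u \<le> 1" "w = u *\<^sub>R z"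
        using w by (auto simp: in_segment)
      have "Re w \<le> u * \<bar>Re z\<bar>"
        using u mult_left_mono[OF abs_ge_self[of "Re z"] u(1)] by simp
      also have "\<dots> \<le> \<bar>Re z\<bar>"
        using u by (intro mult_left_le_one_le) auto
      finally show ?thesis by simp
    qed
  qed (auto intro!: derivative_eq_intros)
  then show ?thesis by (simp add: mult.commute)
qed

text \<open>Differentiating \<open>exp (y * s)\<close> under the integral produces a factor
  \<open>s\<close>, which lowers the power in the denominator by one. As
  \<open>\<bar>h n\<bar> \<le> 1\<close>, the difference quotient costs at most the factor
  \<open>exp c\<close>, so the integrand of order \<open>p\<close>, already integrable, dominates.
  The increments are negative to match \<open>riesz_sum_left_derivative\<close>.\<close>

lemma bromwich_left_derivative:
  assumes hol: "g holomorphic_on {s. a < Re s}" "0 \<le> a" "a < c" and p: "N + 2 \<le> p"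
    and bound: "\<And>t. cmod (g (Complex c t)) \<le> B * (1 + cmod (Complex c t)) ^ N"
  defines "h \<equiv> \<lambda>n. - inverse (real (Suc n))"
  shows "(\<lambda>n. (bromwich (Suc p) g (y + h n) c - bromwich (Suc p) g y c) / of_real (h n))
           \<longlonglongrightarrow> bromwich p g y c"
proof -
  let ?K = "\<lambda>p y t. g (Complex c t) * exp (of_real y * Complex c t) / Complex c t ^ p"
  have "0 < c" using assms by simp
  have nz: "Complex c t \<noteq> 0" for t
    using \<open>0 < c\<close> by (simp add: complex_eq_iff)
  have h: "h n \<noteq> 0" "\<bar>h n\<bar> \<le> 1" for n
    by (auto simp: h_def field_simps)
  have int: "integrable lborel (?K q y)" if "p \<le> q" for q y
    by (rule bromwich_integrable[OF hol, of N _ B]) (use p bound that in auto)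
  have int': "integrable lborel (?K (Suc p) y)" for y
    by (rule int) simp
  have *: "(bromwich (Suc p) g (y + h n) c - bromwich (Suc p) g y c) / of_real (h n)
      = (LINT t|lborel. (?K (Suc p) (y + h n) t - ?K (Suc p) y t) / of_real (h n))" for n
    unfolding bromwich_def
    by (simp only: integral_divide_zero Bochner_Integration.integral_diff[OF int' int'])
  have eq: "(?K (Suc p) (y + h n) t - ?K (Suc p) y t) / of_real (h n)
      = ?K p y t * ((exp (of_real (h n) * Complex c t) - 1) / (of_real (h n) * Complex c t))" for n t
  proof -
    have "exp (of_real (y + h n) * Complex c t) = exp (of_real y * Complex c t) * exp (of_real (h n) * Complex c t)"
      by (simp only: of_real_add distrib_right exp_add)
    moreover have "(a * (e * E) / z ^ Suc p - a * e / z ^ Suc p) / k = a * e / z ^ p * ((E - 1) / (k * z))"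
      for a e E z k :: complex
      by (simp only: diff_divide_distrib[symmetric] right_diff_distrib[symmetric] times_divide_times_eq
          divide_divide_eq_left mult.assoc power_Suc2) (simp add: mult_ac algebra_simps)
    ultimately show ?thesis by (simp only:)
  qed
  show ?thesis
    unfolding * unfolding bromwich_def
  proof (rule integral_dominated_convergence)
    show "?K p y \<in> borel_measurable lborel"
      by (rule borel_measurable_integrable[OF int[OF order_refl]])
    show "(\<lambda>t. (?K (Suc p) (y + h n) t - ?K (Suc p) y t) / of_real (h n)) \<in> borel_measurable lborel" for n
      by (intro borel_measurable_integrable integrable_divide Bochner_Integration.integrable_diff int')
    show "integrable lborel (\<lambda>t. norm (?K p y t) * exp c)"
      using int by auto
    show "AE t in lborel. norm ((?K (Suc p) (y + h n) t - ?K (Suc p) y t) / of_real (h n)) \<le> norm (?K p y t) * exp c" for n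
    proof (rule AE_I2)
      fix t :: real
      have "cmod (exp (of_real (h n) * Complex c t) - 1)
          \<le> cmod (of_real (h n) * Complex c t) * exp \<bar>Re (of_real (h n) * Complex c t)\<bar>"
        by (rule cmod_exp_minus_one_le)
      also have "\<dots> \<le> cmod (of_real (h n) * Complex c t) * exp c"
        using h(2)[of n] \<open>0 < c\<close> by (intro mult_left_mono) (auto simp: abs_mult intro: mult_left_le_one_le)
      finally have "cmod ((exp (of_real (h n) * Complex c t) - 1) / (of_real (h n) * Complex c t)) \<le> exp c"
        using h(1)[of n] nz[of t] unfolding norm_divide
        by (subst pos_divide_le_eq) (auto simp: mult.commute)
      then show "norm ((?K (Suc p) (y + h n) t - ?K (Suc p) y t) / of_real (h n)) \<le> norm (?K p y t) * exp c"
        unfolding eq norm_mult[of "?K p y t"] by (rule mult_left_mono) simp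
    qed
    show "AE t in lborel. (\<lambda>n. (?K (Suc p) (y + h n) t - ?K (Suc p) y t) / of_real (h n)) \<longlonglongrightarrow> ?K p y t"
    proof (rule AE_I2)
      fix t :: real
      have "(\<lambda>n. of_real (h n) * Complex c t) \<longlonglongrightarrow> of_real (-0) * Complex c t"
        unfolding h_def by (intro tendsto_intros LIMSEQ_inverse_real_of_nat)
      then have "filterlim (\<lambda>n. of_real (h n) * Complex c t) (at 0) sequentially"
        using h nz by (intro filterlim_atI) auto
      moreover have "((\<lambda>z::complex. (exp z - 1) / z) \<longlongrightarrow> 1) (at 0)"
        using DERIV_exp[of "0::complex"] by (simp add: has_field_derivative_iff)
      ultimately have "(\<lambda>n. (exp (of_real (h n) * Complex c t) - 1) / (of_real (h n) * Complex c t)) \<longlonglongrightarrow> 1"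
        by (rule filterlim_compose[rotated])
      then have "(\<lambda>n. ?K p y t * ((exp (of_real (h n) * Complex c t) - 1) / (of_real (h n) * Complex c t))) \<longlonglongrightarrow> ?K p y t * 1"
        by (rule tendsto_mult_left)
      then show "(\<lambda>n. (?K (Suc p) (y + h n) t - ?K (Suc p) y t) / of_real (h n)) \<longlonglongrightarrow> ?K p y t"
        unfolding eq by simp
    qed
  qed
qed


text \<open>By \<open>bromwich_one_pos\<close> the integral of order \<open>Suc p\<close> is a
  constant times \<open>u ^ p\<close>; its derivative at \<open>u = 1\<close> is computed once from
  this formula and once under the integral sign.\<close>

lemma bromwich_const_rec:
  assumes "2 \<le> p"
  shows "bromwich p (\<lambda>_. 1) 1 1 = of_nat p * bromwich (Suc p) (\<lambda>_. 1) 1 1"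
proof -
  define h where "h n = - inverse (real (Suc n))" for n
  let ?C = "bromwich (Suc p) (\<lambda>_. 1) 1 1"
  have h0: "h \<longlonglongrightarrow> -0"
    unfolding h_def by (intro tendsto_intros LIMSEQ_inverse_real_of_nat)
  have hf: "filterlim (\<lambda>n. of_real (h n) :: complex) (at 0) sequentially"
    using tendsto_of_real[OF h0, where ?'a = complex] by (intro filterlim_atI) (auto simp: h_def simp del: of_nat_Suc)
  have "((\<lambda>z::complex. z ^ p * ?C) has_field_derivative of_nat p * ?C) (at 1)"
    by (auto intro!: derivative_eq_intros)
  then have "((\<lambda>z::complex. ((1 + z) ^ p * ?C - 1 ^ p * ?C) / z) \<longlongrightarrow> of_nat p * ?C) (at 0)"
    by (rule DERIV_D)
  from filterlim_compose[OF this hf]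
  have 1: "(\<lambda>n. ((1 + of_real (h n)) ^ p * ?C - ?C) / of_real (h n)) \<longlonglongrightarrow> of_nat p * ?C"
    by simp
  have "(\<lambda>n. (bromwich (Suc p) (\<lambda>_. 1) (1 + h n) 1 - ?C) / of_real (h n)) \<longlonglongrightarrow> bromwich p (\<lambda>_. 1) 1 1"
    unfolding h_def by (rule bromwich_left_derivative[where a = 0 and N = 0 and B = 1]) (use assms in auto)
  moreover have "\<forall>\<^sub>F n in sequentially. (bromwich (Suc p) (\<lambda>_. 1) (1 + h n) 1 - ?C) / of_real (h n)
      = ((1 + of_real (h n)) ^ p * ?C - ?C) / of_real (h n)"
  \<comment> \<open>The index \<open>0\<close> is excluded because \<open>h 0 = -1\<close> would
    make the argument \<open>1 + h n\<close> vanish.\<close>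
  proof (rule eventually_sequentiallyI[of 1])
    fix n :: nat assume "1 \<le> n"
    then have "0 < 1 + h n"
      by (simp add: h_def field_simps)
    then show "(bromwich (Suc p) (\<lambda>_. 1) (1 + h n) 1 - ?C) / of_real (h n)
      = ((1 + of_real (h n)) ^ p * ?C - ?C) / of_real (h n)"
      using bromwich_one_pos[of "Suc p" "1 + h n" 1] assms by simp
  qed
  ultimately have "(\<lambda>n. ((1 + of_real (h n)) ^ p * ?C - ?C) / of_real (h n)) \<longlonglongrightarrow> bromwich p (\<lambda>_. 1) 1 1"
    by (rule Lim_transform_eventually)
  then show ?thesis
    using 1 LIMSEQ_unique by blast
qed

lemma cross_multiply_le:
  fixes a b c d :: real
  assumes "0 < c" "0 < d" "a * d \<le> b * c"
  shows "a / c \<le> b / d"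
  using assms by (simp add: field_simps)

text \<open>The second difference of \<open>u \<mapsto> bromwich 2 1 u 1\<close> at \<open>0\<close> is the integral of the entire function
  \<open>((exp (s/2) - exp (-s/2)) / s)\<^sup>2\<close>, which is nonnegative on the imaginary axis.\<close>

lemma bromwich_2_neq_0: "bromwich 2 (\<lambda>_. 1) 1 1 \<noteq> 0"
proof -
  \<comment> \<open>The removable singularity of \<open>(exp z - 1) / z\<close> is filled in, in the
    shape expected by \<open>pole_lemma\<close>. The prefactor \<open>exp (- s)\<close> of
    \<open>H\<close> symmetrises the square to \<open>exp s + exp (- s) - 2\<close>.\<close>
  define E where "E z = (if z = 0 then deriv exp 0 else (exp z - exp 0) / (z - 0))" for z :: complex
  define H where "H s = exp (- s) * (E s)\<^sup>2" for s
  have "E holomorphic_on UNIV"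
    unfolding E_def[abs_def] by (rule pole_lemma) (auto intro!: holomorphic_intros)
  then have hol: "H holomorphic_on UNIV"
    unfolding H_def[abs_def] by (auto intro!: holomorphic_intros)
  then have hol': "H holomorphic_on {s. -1 < Re s}"
    by (rule holomorphic_on_subset) simp
  have H: "H s = (exp s + exp (- s) - 2) / s\<^sup>2" if "s \<noteq> 0" for s
  proof -
    have "exp (- s) * (exp s - 1)\<^sup>2 = exp (-s) * exp s * exp s - 2 * (exp (-s) * exp s) + exp (-s)"
      by (simp add: power2_eq_square algebra_simps)
    also have "exp (-s) * exp s = 1"
      by (simp flip: exp_add)
    finally show ?thesis
      using that by (simp add: H_def E_def power_divide)
  qed
  \<comment> \<open>The quotient form of \<open>H\<close> gives nothing near \<open>s = 0\<close>,
    so compactness bounds the part with \<open>\<bar>Im s\<bar> \<le> 1\<close>. Beyond it the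
    numerator is at most \<open>exp 1 + 1 + 2\<close> on the strip, and
    \<open>1 + (Im s)\<^sup>2 \<le> 2 * (cmod s)\<^sup>2\<close>.\<close>
  have "\<exists>B. \<forall>s. 0 \<le> Re s \<longrightarrow> Re s \<le> 1 \<longrightarrow> cmod (H s) \<le> B / (1 + (Im s)\<^sup>2)"
  proof -
    have "compact (H ` cbox (Complex 0 (-1)) (Complex 1 1))"
      by (intro compact_continuous_image compact_cbox
          continuous_on_subset[OF holomorphic_on_imp_continuous_on[OF hol]]) auto
    then obtain M where M: "\<And>s. s \<in> cbox (Complex 0 (-1)) (Complex 1 1) \<Longrightarrow> cmod (H s) \<le> M"
      using compact_imp_bounded[of "H ` cbox (Complex 0 (-1)) (Complex 1 1)"]
      unfolding bounded_iff by blast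
    have "cmod (H s) \<le> max (2 * M) (2 * (exp 1 + 3)) / (1 + (Im s)\<^sup>2)" if s: "0 \<le> Re s" "Re s \<le> 1" for s
    proof (cases "\<bar>Im s\<bar> \<le> 1")
      case True
      then have "cmod (H s) \<le> M"
        using s by (intro M) (auto simp: in_cbox_complex_iff)
      moreover have "(Im s)\<^sup>2 \<le> 1"
        using True by (simp add: abs_square_le_1)
      ultimately have "cmod (H s) * (1 + (Im s)\<^sup>2) \<le> M * 2"
        using norm_ge_zero[of "H s"] by (intro mult_mono) (linarith | simp)+
      then have "cmod (H s) \<le> 2 * M / (1 + (Im s)\<^sup>2)"
        by (subst pos_le_divide_eq) (simp_all add: add_pos_nonneg mult.commute)
      also have "\<dots> \<le> max (2 * M) (2 * (exp 1 + 3)) / (1 + (Im s)\<^sup>2)"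
        by (rule divide_right_mono) auto
      finally show ?thesis .
    next
      case False
      then have I: "1 \<le> (Im s)\<^sup>2" "s \<noteq> 0"
        using abs_square_le_1[of "Im s"] by auto
      have "cmod (exp s + exp (- s) - 2) \<le> cmod (exp s) + cmod (exp (- s)) + 2"
        by (intro order_trans[OF norm_triangle_ineq4] add_mono norm_triangle_ineq) auto
      also have "\<dots> \<le> exp 1 + 3"
      proof -
        have "exp (Re s) \<le> exp 1" "exp (- Re s) \<le> 1"
          using s by auto
        then show ?thesis unfolding norm_exp_eq_Re uminus_complex.simps by linarith
      qed
      finally have 1: "cmod (exp s + exp (- s) - 2) \<le> exp 1 + 3" .
      have "1 + (Im s)\<^sup>2 \<le> 2 * (cmod s)\<^sup>2"
      proof -
        have "1 + y \<le> 2 * (x + y)" if "1 \<le> y" "0 \<le> x" for x y :: real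
          using that by simp
        then show ?thesis
          unfolding cmod_power2 using I(1) zero_le_power2 by blast
      qed
      then have "cmod (exp s + exp (- s) - 2) * (1 + (Im s)\<^sup>2) \<le> (exp 1 + 3) * (2 * (cmod s)\<^sup>2)"
        by (intro mult_mono 1) (simp_all add: add_nonneg_nonneg)
      then have "cmod (exp s + exp (- s) - 2) / (cmod s)\<^sup>2 \<le> 2 * (exp 1 + 3) / (1 + (Im s)\<^sup>2)"
        using I(2) by (intro cross_multiply_le) (simp_all add: add_pos_nonneg algebra_simps)
      then have "cmod (H s) \<le> 2 * (exp 1 + 3) / (1 + (Im s)\<^sup>2)"
        by (simp only: H[OF I(2)] norm_divide norm_power)
      also have "\<dots> \<le> max (2 * M) (2 * (exp 1 + 3)) / (1 + (Im s)\<^sup>2)"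
        by (rule divide_right_mono) auto
      finally show ?thesis .
    qed
    then show ?thesis by (intro exI allI impI)
  qed
  then obtain B where B: "\<And>s. 0 \<le> Re s \<Longrightarrow> Re s \<le> 1 \<Longrightarrow> cmod (H s) \<le> B / (1 + (Im s)\<^sup>2)"
    by blast
  let ?F = "\<lambda>u t. 1 * exp (of_real u * Complex 1 t) / Complex 1 t ^ 2"
  have int: "integrable lborel (?F u)" for u
    by (rule bromwich_integrable[where a = 0 and N = 0 and B = 1]) auto
  \<comment> \<open>The added terms are zero by \<open>bromwich_one_nonpos\<close>. They complete
    the second difference, in which the double pole at \<open>0\<close> cancels, so that the line
    may then be moved onto the imaginary axis.\<close>
  have "bromwich 2 (\<lambda>_. 1) 1 1 = bromwich 2 (\<lambda>_. 1) 1 1 + bromwich 2 (\<lambda>_. 1) (-1) 1 - 2 * bromwich 2 (\<lambda>_. 1) 0 1"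
    by (simp add: bromwich_one_nonpos)
  also have "\<dots> = (LINT t|lborel. ?F 1 t + ?F (-1) t - 2 * ?F 0 t)"
    unfolding bromwich_def
    by (simp only: Bochner_Integration.integral_add Bochner_Integration.integral_diff
        integral_mult_right_zero int integrable_mult_right Bochner_Integration.integrable_add)
  also have "\<dots> = (LINT t|lborel. H (Complex 1 t))"
  proof (rule Bochner_Integration.integral_cong[OF refl])
    fix t
    have "Complex 1 t \<noteq> 0" by (simp add: complex_eq_iff)
    from H[OF this] show "?F 1 t + ?F (-1) t - 2 * ?F 0 t = H (Complex 1 t)"
      by (simp add: add_divide_distrib diff_divide_distrib)
  qed
  also have "\<dots> = (LINT t|lborel. H (Complex 0 t))"
    by (rule sym, rule vertical_line_shift_le[OF hol', of 0 1 B]) (use B in auto)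
  finally have eq: "bromwich 2 (\<lambda>_. 1) 1 1 = (LINT t|lborel. H (Complex 0 t))" .
  have intH: "integrable lborel (\<lambda>t. H (Complex 0 t))"
    by (rule integrable_vertical_line[OF hol', of 0 B]) (use B[of "Complex 0 _"] in auto)
  have ReH: "Re (H (Complex 0 t)) = 2 * (1 - cos t) / t\<^sup>2" if "t \<noteq> 0" for t
  proof -
    have nz: "Complex 0 t \<noteq> 0" using that by (simp add: complex_eq_iff)
    have "exp (Complex 0 t) + exp (- Complex 0 t) - 2 = of_real (2 * cos t - 2)"
      by (simp add: complex_eq_iff Re_exp Im_exp)
    moreover have "(Complex 0 t)\<^sup>2 = of_real (- t\<^sup>2)"
      by (simp add: complex_eq_iff power2_eq_square)
    ultimately have "H (Complex 0 t) = of_real ((2 * cos t - 2) / (- t\<^sup>2))"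
      by (simp only: H[OF nz] of_real_divide)
    then show ?thesis
      by (simp only: Re_complex_of_real) (simp add: divide_simps that)
  qed
  \<comment> \<open>On \<open>{1..2}\<close> one has \<open>cos t \<le> cos 1\<close> and
    \<open>t\<^sup>2 \<le> 4\<close>, so the integrand is at least
    \<open>2 * (1 - cos 1) / 4\<close>. The interval has length one, hence \<open>m\<close> also
    bounds the integral from below.\<close>
  define m :: real where "m = (1 - cos 1) / 2"
  have "0 < m"
    using cos_monotone_0_pi[of 0 1] pi_gt3 by (simp add: m_def)
  have low: "indicator {1..2} t * m \<le> Re (H (Complex 0 t))" if "t \<noteq> 0" for t :: real
  proof (cases "t \<in> {1..2}")
    case True
    then have "cos t \<le> cos 1"
      using pi_gt3 by (intro cos_monotone_0_pi_le) auto
    moreover have "t\<^sup>2 \<le> 4"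
      using True power_mono[of t 2 2] by simp
    moreover have "cos 1 \<le> (1::real)" by simp
    ultimately have "2 * (1 - cos 1) / 4 \<le> 2 * (1 - cos t) / t\<^sup>2"
      using that by (intro frac_le) auto
    moreover have "2 * (1 - cos 1) / 4 = m"
      by (simp add: m_def)
    ultimately show ?thesis
      using True by (simp only: ReH[OF that] indicator_simps mult_1)
  next
    case False
    then show ?thesis
      using that by (simp add: ReH)
  qed
  have "m = (LINT t::real|lborel. indicator {1..2} t * m)"
    by (simp add: mult.commute)
  also have "\<dots> \<le> (LINT t|lborel. Re (H (Complex 0 t)))"
  proof (rule integral_mono_AE)
    show "integrable lborel (\<lambda>t::real. indicator {1..2} t * m)"
      by (intro integrable_mult_left integrable_real_indicator) simp_all
    show "integrable lborel (\<lambda>t. Re (H (Complex 0 t)))"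
      by (rule integrable_Re[OF intH])
    show "AE t in lborel. indicator {1..2} t * m \<le> Re (H (Complex 0 t))"
      using AE_lborel_singleton[of "0::real"] by eventually_elim (rule low)
  qed
  also have "\<dots> = Re (bromwich 2 (\<lambda>_. 1) 1 1)"
    unfolding eq by (rule integral_Re[OF intH])
  finally have "0 < Re (bromwich 2 (\<lambda>_. 1) 1 1)"
    using \<open>0 < m\<close> by linarith
  then show ?thesis
    using zero_complex.sel(1) less_irrefl by metis
qed

lemma bromwich_const_neq_0: "2 \<le> p \<Longrightarrow> bromwich p (\<lambda>_. 1) 1 1 \<noteq> 0"
proof (induction p rule: dec_induct)
  case base
  show ?case by (rule bromwich_2_neq_0)
next
  case (step n)
  show ?case
  proof
    assume "bromwich (Suc n) (\<lambda>_. 1) 1 1 = 0"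
    then have "bromwich n (\<lambda>_. 1) 1 1 = 0"
      unfolding bromwich_const_rec[OF step(1)] by simp
    with step(3) show False by simp
  qed
qed

subsection \<open>Riesz means of increasing order\<close>

lemma frequency_finite:
  assumes "frequency lam"
  shows "finite {n. lam n < x}"
proof -
  have "\<forall>\<^sub>F n in sequentially. x \<le> lam n"
    using assms unfolding frequency_def filterlim_at_top by blast
  then obtain n0 where n0: "\<And>n. n \<ge> n0 \<Longrightarrow> x \<le> lam n"
    by (auto simp: eventually_sequentially)
  have "{n. lam n < x} \<subseteq> {..<n0}"
    using n0 by (force simp: not_le[symmetric])
  then show ?thesis
    using finite_subset by blast
qed

lemma frequency_nonneg: "frequency lam \<Longrightarrow> 0 \<le> lam n"
  by (simp add: frequency_def)

text \<open>A fixed index set \<open>F\<close> moves the dependence on \<open>t\<close> from the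
  range of summation into the summands, so that means at different \<open>t\<close> can be compared
  term by term.\<close>

lemma riesz_mean_expand:
  assumes "finite F" "{n. lam n < t} \<subseteq> F"
  shows "riesz_mean lam a m t s =
    (\<Sum>n\<in>F. if lam n < t then a n * exp (- of_real (lam n) * s) * of_real ((1 - lam n / t) powr m) else 0)"
proof -
  have "{n. lam n < t} = {n \<in> F. lam n < t}"
    using assms by auto
  then show ?thesis
    unfolding riesz_mean_def using assms(1) by (simp only: sum.inter_filter)
qed

text \<open>Convergence controls all \<open>x \<ge> T\<close>. Below \<open>T\<close> only the
  finitely many frequencies smaller than \<open>T\<close> occur, and each Riesz weight is at most
  \<open>1\<close>.\<close>

lemma riesz_mean_bounded:
  assumes freq: "frequency lam" and "0 \<le> m"
    and lim: "((\<lambda>x. riesz_mean lam a m x s) \<longlongrightarrow> L) at_top"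
  obtains M where "\<And>x. cmod (riesz_mean lam a m x s) \<le> M"
proof -
  have "\<forall>\<^sub>F x in at_top. dist (riesz_mean lam a m x s) L < 1"
    using lim by (rule tendstoD) simp
  then obtain T where T: "\<And>x. x \<ge> T \<Longrightarrow> dist (riesz_mean lam a m x s) L < 1"
    by (auto simp: eventually_at_top_linorder)
  define F where "F = {n. lam n < T}"
  have F: "finite F"
    unfolding F_def by (rule frequency_finite[OF freq])
  define S where "S = (\<Sum>n\<in>F. cmod (a n * exp (- of_real (lam n) * s)))"
  have "cmod (riesz_mean lam a m x s) \<le> max (cmod L + 1) S" for x
  proof (cases "x \<ge> T")
    case True
    have "cmod (riesz_mean lam a m x s) \<le> cmod L + cmod (riesz_mean lam a m x s - L)"
      using norm_triangle_ineq[of L "riesz_mean lam a m x s - L"] by simp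
    also have "\<dots> \<le> cmod L + 1"
      using T[OF True] by (simp add: dist_norm)
    finally show ?thesis by simp
  next
    case False
    then have sub: "{n. lam n < x} \<subseteq> F"
      by (auto simp: F_def)
    have "cmod (riesz_mean lam a m x s) \<le> S"
      unfolding riesz_mean_expand[OF F sub] S_def
    proof (rule sum_norm_le)
      fix n
      show "cmod (if lam n < x then a n * exp (- of_real (lam n) * s) * of_real ((1 - lam n / x) powr m) else 0)
         \<le> cmod (a n * exp (- of_real (lam n) * s))"
      proof (cases "lam n < x")
        case True
        then have "0 < x"
          using frequency_nonneg[OF freq, of n] by linarith
        then have "(1 - lam n / x) powr m \<le> 1 powr m"
          using True frequency_nonneg[OF freq, of n] \<open>0 \<le> m\<close> by (intro powr_mono2) auto
        then have "cmod (a n * exp (- of_real (lam n) * s)) * (1 - lam n / x) powr m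
            \<le> cmod (a n * exp (- of_real (lam n) * s)) * 1"
          by (intro mult_left_mono) auto
        then show ?thesis
          using True by (simp only: norm_mult[of "a n * _"] norm_of_real if_True abs_of_nonneg powr_ge_zero mult_1_right)
      qed simp
    qed
    then show ?thesis by simp
  qed
  then show ?thesis by (rule that)
qed

section \<open>Raising the order by a beta average\<close>

definition beta_kernel :: "real \<Rightarrow> real \<Rightarrow> real \<Rightarrow> real" where
  "beta_kernel m q u = indicator {0<..<1} u * (u powr m * (1 - u) powr q)"

lemma beta_kernel_measurable [measurable]: "beta_kernel m q \<in> borel_measurable lborel"
  unfolding beta_kernel_def by measurable

lemma beta_kernel_nonneg: "0 \<le> beta_kernel m q u"
  by (simp add: beta_kernel_def)

lemma beta_kernel_integrable:
  assumes "0 \<le> m" "0 \<le> q"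
  shows "integrable lborel (beta_kernel m q)"
proof (rule Bochner_Integration.integrable_bound[of _ "indicator {0..1::real} :: real \<Rightarrow> real"])
  show "integrable lborel (indicator {0..1::real} :: real \<Rightarrow> real)"
    by (rule integrable_real_indicator) simp_all
  show "AE u in lborel. norm (beta_kernel m q u) \<le> norm (indicator {0..1} u :: real)"
  proof (rule AE_I2)
    fix u :: real
    show "norm (beta_kernel m q u) \<le> norm (indicator {0..1} u :: real)"
    proof (cases "u \<in> {0<..<1}")
      case True
      then have "u powr m * (1 - u) powr q \<le> 1 * 1"
        using assms by (intro mult_mono powr_le1) auto
      then show ?thesis
        using True by (simp add: beta_kernel_def)
    qed (simp add: beta_kernel_def)
  qed
qed measurable

lemma beta_kernel_integral_pos:
  assumes "0 \<le> m" "0 \<le> q"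
  shows "0 < (LINT u|lborel. beta_kernel m q u)"
proof -
  define b :: real where "b = (1/4) powr m * (1/4) powr q"
  have "0 < b" by (simp add: b_def)
  have "b / 2 = (LINT u::real|lborel. indicator {1/4..3/4} u * b)"
    by simp
  also have "\<dots> \<le> (LINT u|lborel. beta_kernel m q u)"
  proof (rule integral_mono)
    have eq: "emeasure lborel {1/4..3/4::real} = ennreal (3/4 - 1/4)"
      by (rule emeasure_lborel_Icc) simp
    show "integrable lborel (\<lambda>u::real. indicator {1/4..3/4} u * b)"
      by (intro integrable_mult_left integrable_real_indicator)
         (simp_all only: eq ennreal_less_top infinity_ennreal_def, simp)
    show "integrable lborel (beta_kernel m q)"
      by (rule beta_kernel_integrable[OF assms])
    show "indicator {1/4..3/4} u * b \<le> beta_kernel m q u" for u :: real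
    proof (cases "u \<in> {1/4..3/4}")
      case True
      then have "b \<le> u powr m * (1 - u) powr q"
        unfolding b_def using assms by (intro mult_mono powr_mono2) auto
      then show ?thesis
        using True by (simp add: beta_kernel_def)
    qed (simp add: beta_kernel_nonneg)
  qed
  finally show ?thesis
    using \<open>0 < b\<close> by linarith
qed

text \<open>The substitution \<open>u = \<alpha> + (1 - \<alpha>) * v\<close> reduces the integral
  to the beta integral: \<open>u powr m * (1 - \<alpha> / u) powr m\<close> is
  \<open>(u - \<alpha>) powr m\<close>, and both \<open>u - \<alpha>\<close> and
  \<open>1 - u\<close> release a factor \<open>1 - \<alpha>\<close>. The Jacobian accounts for the
  \<open>1\<close> in the exponent.\<close>

lemma beta_kernel_shifted:
  assumes "0 \<le> \<alpha>" "\<alpha> < 1" "0 \<le> m" "0 \<le> q"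
  defines "f \<equiv> \<lambda>u. beta_kernel m q u * (if \<alpha> < u then (1 - \<alpha> / u) powr m else 0)"
  shows "integrable lborel f" and "(LINT u|lborel. f u) = (1 - \<alpha>) powr (m + q + 1) * (LINT u|lborel. beta_kernel m q u)"
proof -
  show "integrable lborel f"
  proof (rule Bochner_Integration.integrable_bound[OF beta_kernel_integrable[OF assms(3,4)]])
    show "f \<in> borel_measurable lborel"
      unfolding f_def by measurable
    show "AE u in lborel. norm (f u) \<le> norm (beta_kernel m q u)"
    proof (rule AE_I2)
      fix u :: real
      have "\<bar>if \<alpha> < u then (1 - \<alpha> / u) powr m else 0\<bar> \<le> 1"
        using assms(1,3) by (auto intro!: powr_le1 simp: field_simps)
      then show "norm (f u) \<le> norm (beta_kernel m q u)"
        unfolding f_def real_norm_def abs_mult by (intro mult_left_le) auto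
    qed
  qed
  have *: "f (\<alpha> + (1 - \<alpha>) * v) = (1 - \<alpha>) powr (m + q) * beta_kernel m q v" for v
  proof (cases "0 < v \<and> v < 1")
    case True
    define u where "u = \<alpha> + (1 - \<alpha>) * v"
    have 1: "u - \<alpha> = (1 - \<alpha>) * v" "1 - u = (1 - \<alpha>) * (1 - v)"
      by (auto simp: u_def algebra_simps)
    have "0 < (1 - \<alpha>) * v" "0 < (1 - \<alpha>) * (1 - v)"
      using True assms(2) by auto
    then have "0 < u - \<alpha>" "0 < 1 - u"
      by (simp_all only: 1)
    then have 2: "\<alpha> < u" "u < 1" "0 < u"
      using assms(1) by linarith+
    have "u powr m * (1 - \<alpha> / u) powr m = (u * (1 - \<alpha> / u)) powr m"
      by (rule powr_mult[symmetric])
    also have "u * (1 - \<alpha> / u) = (1 - \<alpha>) * v"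
      unfolding 1(1)[symmetric] using 2 by (simp add: right_diff_distrib)
    also have "\<dots> powr m = (1 - \<alpha>) powr m * v powr m"
      by (rule powr_mult)
    finally have 3: "u powr m * (1 - \<alpha> / u) powr m = (1 - \<alpha>) powr m * v powr m" .
    have 4: "(1 - u) powr q = (1 - \<alpha>) powr q * (1 - v) powr q"
      unfolding 1 by (rule powr_mult)
    have "f u = (u powr m * (1 - \<alpha> / u) powr m) * (1 - u) powr q"
      using 2 by (simp add: f_def beta_kernel_def mult_ac)
    also have "\<dots> = (1 - \<alpha>) powr (m + q) * beta_kernel m q v"
      unfolding 3 4 using True by (simp add: beta_kernel_def powr_add mult_ac)
    finally show ?thesis
      by (simp add: u_def)
  next
    case False
    then have "v \<le> 0 \<or> 1 \<le> v" by auto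
    then have "(1 - \<alpha>) * v \<le> 0 \<or> 0 \<le> (1 - \<alpha>) * (v - 1)"
      using assms(2) by (auto simp: mult_le_0_iff)
    then have "\<alpha> + (1 - \<alpha>) * v \<le> \<alpha> \<or> 1 \<le> \<alpha> + (1 - \<alpha>) * v"
      by (auto simp: algebra_simps)
    then have "f (\<alpha> + (1 - \<alpha>) * v) = 0"
      by (auto simp: f_def beta_kernel_def)
    moreover have "beta_kernel m q v = 0"
      using False by (auto simp: beta_kernel_def)
    ultimately show ?thesis by simp
  qed
  have "(LINT u|lborel. f u) = (1 - \<alpha>) * (LINT v|lborel. f (\<alpha> + (1 - \<alpha>) * v))"
    using lborel_integral_real_affine[of "1 - \<alpha>" f \<alpha>] assms(2) by simp
  also have "\<dots> = (1 - \<alpha>) * ((1 - \<alpha>) powr (m + q) * (LINT u|lborel. beta_kernel m q u))"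
    unfolding * by simp
  also have "\<dots> = (1 - \<alpha>) powr (m + q + 1) * (LINT u|lborel. beta_kernel m q u)"
    using assms(2) by (simp add: powr_add)
  finally show "(LINT u|lborel. f u) = (1 - \<alpha>) powr (m + q + 1) * (LINT u|lborel. beta_kernel m q u)" .
qed

lemma riesz_mean_beta_expand:
  assumes freq: "frequency lam"
  shows "beta_kernel m q u *\<^sub>R riesz_mean lam a m (x * u) s =
    (\<Sum>n | lam n < x. (beta_kernel m q u * (if lam n / x < u then (1 - lam n / x / u) powr m else 0))
       *\<^sub>R (a n * exp (- of_real (lam n) * s)))"
proof (cases "u \<in> {0<..<1}")
  case True
  show ?thesis
  proof (cases "0 < x")
    case x: True
    have "x * u \<le> x"
      using True x by simp
    then have sub: "{n. lam n < x * u} \<subseteq> {n. lam n < x}"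
      by auto
    have "(lam n < x * u) = (lam n / x < u)" for n
      using x by (simp add: field_simps)
    then show ?thesis
      unfolding riesz_mean_expand[OF frequency_finite[OF freq] sub] scaleR_sum_right
      by (intro sum.cong refl) (auto simp: scaleR_conv_of_real)
  next
    case x: False
    then have "x * u \<le> 0"
      using True by (intro mult_nonpos_nonneg) auto
    then have "\<not> lam n < x * u" "\<not> lam n < x" for n
      using x frequency_nonneg[OF freq, of n] by linarith+
    then show ?thesis
      by (simp add: riesz_mean_def)
  qed
qed (simp add: beta_kernel_def)

text \<open>With \<open>\<alpha> = lam n / x\<close>, \<open>beta_kernel_shifted\<close> turns each
  weight of order \<open>m\<close> at \<open>x * u\<close> into one of order
  \<open>m + q + 1\<close> at \<open>x\<close>. Thus a mean of higher order is, up to the mass of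
  the kernel, an average of means of lower order at smaller arguments.\<close>

lemma riesz_mean_beta:
  assumes freq: "frequency lam" and "0 \<le> m" "0 \<le> q"
  shows "(LINT u|lborel. beta_kernel m q u *\<^sub>R riesz_mean lam a m (x * u) s)
    = of_real (LINT u|lborel. beta_kernel m q u) * riesz_mean lam a (m + q + 1) x s"
proof -
  let ?f = "\<lambda>n u. beta_kernel m q u * (if lam n / x < u then (1 - lam n / x / u) powr m else 0)"
  have f: "integrable lborel (?f n)"
    "(LINT u|lborel. ?f n u) = (1 - lam n / x) powr (m + q + 1) * (LINT u|lborel. beta_kernel m q u)"
    if "lam n < x" for n
    using beta_kernel_shifted[of "lam n / x" m q] that frequency_nonneg[OF freq, of n] assms(2,3)
    by auto
  have "(LINT u|lborel. beta_kernel m q u *\<^sub>R riesz_mean lam a m (x * u) s)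
      = (\<Sum>n | lam n < x. LINT u|lborel. ?f n u *\<^sub>R (a n * exp (- of_real (lam n) * s)))"
    unfolding riesz_mean_beta_expand[OF freq]
    by (rule Bochner_Integration.integral_sum) (auto intro!: integrable_scaleR_left f)
  also have "\<dots> = (\<Sum>n | lam n < x. (LINT u|lborel. ?f n u) *\<^sub>R (a n * exp (- of_real (lam n) * s)))"
    by (intro sum.cong refl integral_scaleR_left) (auto intro: f)
  also have "\<dots> = of_real (LINT u|lborel. beta_kernel m q u) * riesz_mean lam a (m + q + 1) x s"
    unfolding riesz_mean_def sum_distrib_left
    by (intro sum.cong refl) (simp add: f scaleR_conv_of_real mult_ac)
  finally show ?thesis .
qed

text \<open>The averages of \<open>riesz_mean_beta\<close> inherit the limit by dominated
  convergence, as \<open>x * u\<close> tends to infinity for each \<open>u\<close> in the open unit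
  interval. The gap of one between the orders makes the exponent \<open>q\<close> nonnegative, so
  the kernel is bounded. This leads from the real order of a germ to integer orders.\<close>

lemma riesz_mean_consistency:
  assumes freq: "frequency lam" and m: "0 \<le> m" "m + 1 \<le> k"
    and lim: "((\<lambda>x. riesz_mean lam a m x s) \<longlongrightarrow> L) at_top"
  shows "((\<lambda>x. riesz_mean lam a k x s) \<longlongrightarrow> L) at_top"
proof -
  define q where "q = k - m - 1"
  have q: "0 \<le> q" "k = m + q + 1"
    using m by (auto simp: q_def)
  obtain M where M: "\<And>x. cmod (riesz_mean lam a m x s) \<le> M"
    using riesz_mean_bounded[OF freq m(1) lim] by blast
  define \<beta> where "\<beta> = (LINT u|lborel. beta_kernel m q u)"
  have "\<beta> \<noteq> 0"
    using beta_kernel_integral_pos[OF m(1) q(1)] by (simp add: \<beta>_def)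
  have "((\<lambda>x. LINT u|lborel. beta_kernel m q u *\<^sub>R riesz_mean lam a m (x * u) s)
      \<longlongrightarrow> (LINT u|lborel. beta_kernel m q u *\<^sub>R L)) at_top"
  proof (rule integral_dominated_convergence_at_top[where w = "\<lambda>u. beta_kernel m q u * M"])
    show "(\<lambda>u. beta_kernel m q u *\<^sub>R L) \<in> borel_measurable lborel"
      by measurable
    show "(\<lambda>u. beta_kernel m q u *\<^sub>R riesz_mean lam a m (x * u) s) \<in> borel_measurable lborel" for x
      unfolding riesz_mean_beta_expand[OF freq] by measurable
    show "integrable lborel (\<lambda>u. beta_kernel m q u * M)"
      by (intro integrable_mult_left beta_kernel_integrable m q)
    show "\<forall>\<^sub>F x in at_top. AE u in lborel. norm (beta_kernel m q u *\<^sub>R riesz_mean lam a m (x * u) s) \<le> beta_kernel m q u * M"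
      by (intro always_eventually allI AE_I2)
         (simp add: beta_kernel_nonneg mult_left_mono M)
    show "AE u in lborel. ((\<lambda>x. beta_kernel m q u *\<^sub>R riesz_mean lam a m (x * u) s) \<longlongrightarrow> beta_kernel m q u *\<^sub>R L) at_top"
    proof (rule AE_I2)
      fix u :: real
      show "((\<lambda>x. beta_kernel m q u *\<^sub>R riesz_mean lam a m (x * u) s) \<longlongrightarrow> beta_kernel m q u *\<^sub>R L) at_top"
      proof (cases "u \<in> {0<..<1}")
        case True
        then have "filterlim (\<lambda>x. x * u) at_top at_top"
          by (intro filterlim_at_top_mult_tendsto_pos[OF tendsto_const]) (auto simp: filterlim_ident)
        from filterlim_compose[OF lim this] show ?thesis
          by (intro tendsto_scaleR tendsto_const)
      qed (simp add: beta_kernel_def)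
    qed
  qed
  then have "((\<lambda>x. of_real \<beta> * riesz_mean lam a k x s) \<longlongrightarrow> of_real \<beta> * L) at_top"
    unfolding riesz_mean_beta[OF freq m(1) q(1)] q(2) \<beta>_def
    by (simp add: scaleR_conv_of_real integral_complex_of_real)
  then have "((\<lambda>x. of_real \<beta> * riesz_mean lam a k x s / of_real \<beta>) \<longlongrightarrow> of_real \<beta> * L / of_real \<beta>) at_top"
    by (rule tendsto_divide) (use \<open>\<beta> \<noteq> 0\<close> in auto)
  then show ?thesis
    using \<open>\<beta> \<noteq> 0\<close> by simp
qed

subsection \<open>Polynomial growth of Riesz means\<close>

text \<open>\<open>exp (u z) * poly (exp_deriv_poly z k j) u\<close> is the \<open>j\<close>-th derivative of \<open>u \<mapsto> exp (u z) * u ^ k\<close>.\<close>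

primrec exp_deriv_poly :: "complex \<Rightarrow> nat \<Rightarrow> nat \<Rightarrow> complex poly" where
  "exp_deriv_poly z k 0 = monom 1 k"
| "exp_deriv_poly z k (Suc j) = smult z (exp_deriv_poly z k j) + pderiv (exp_deriv_poly z k j)"

text \<open>Differentiation feeds coefficient \<open>i\<close> from coefficient
  \<open>i + 1\<close>, so the induction has to run over all \<open>i\<close>. At
  \<open>i = 0\<close> the result says that the derivatives of \<open>exp (u z) * u ^ k\<close> at
  \<open>0\<close> vanish below order \<open>k\<close> and that the \<open>k\<close>-th one is
  \<open>fact k\<close>.\<close>

lemma exp_deriv_poly_low_coeff:
  "(i + j < k \<longrightarrow> coeff (exp_deriv_poly z k j) i = 0) \<and>
   (i + j = k \<longrightarrow> coeff (exp_deriv_poly z k j) i * fact i = fact k)"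
proof (induction j arbitrary: i)
  case (Suc j)
  show ?case
  proof (intro conjI impI)
    assume "i + Suc j < k"
    then show "coeff (exp_deriv_poly z k (Suc j)) i = 0"
      using Suc[of i] Suc[of "Suc i"] by (simp add: coeff_pderiv)
  next
    assume "i + Suc j = k"
    then have "coeff (exp_deriv_poly z k j) i = 0"
      "coeff (exp_deriv_poly z k j) (Suc i) * fact (Suc i) = fact k"
      using Suc[of i] Suc[of "Suc i"] by auto
    then show "coeff (exp_deriv_poly z k (Suc j)) i * fact i = fact k"
      by (simp add: coeff_pderiv mult_ac)
  qed
qed auto

lemma exp_deriv_poly_degree: "degree (exp_deriv_poly z k j) \<le> k"
proof (induction j)
  case (Suc j)
  have "degree (pderiv (exp_deriv_poly z k j)) \<le> k"
    using Suc by (simp add: degree_pderiv)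
  then show ?case
    unfolding exp_deriv_poly.simps
    by (intro degree_add_le order_trans[OF degree_smult_le Suc])
qed (simp add: degree_monom_le)

text \<open>Each step costs a factor \<open>cmod z\<close> from the multiplication by
  \<open>z\<close>, and at most the degree, hence at most \<open>k\<close>, from the
  differentiation.\<close>

lemma exp_deriv_poly_coeff_bound: "cmod (coeff (exp_deriv_poly z k j) i) \<le> (cmod z + real k) ^ j"
proof (induction j arbitrary: i)
  case 0
  then show ?case by simp
next
  case (Suc j)
  let ?p = "exp_deriv_poly z k j"
  have "cmod (of_nat (Suc i) * coeff ?p (Suc i)) \<le> real k * (cmod z + real k) ^ j"
  proof (cases "Suc i \<le> k")
    case True
    have "cmod (of_nat (Suc i) * coeff ?p (Suc i)) = real (Suc i) * cmod (coeff ?p (Suc i))"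
      by (simp only: norm_mult norm_of_nat)
    also have "\<dots> \<le> real k * (cmod z + real k) ^ j"
      using True Suc by (intro mult_mono) auto
    finally show ?thesis .
  next
    case False
    then have "coeff ?p (Suc i) = 0"
      using exp_deriv_poly_degree[of z k j] by (intro coeff_eq_0) simp
    then show ?thesis by simp
  qed
  moreover have "cmod (z * coeff ?p i) \<le> cmod z * (cmod z + real k) ^ j"
    unfolding norm_mult by (intro mult_left_mono Suc) simp
  moreover have "cmod (coeff (exp_deriv_poly z k (Suc j)) i)
      \<le> cmod (z * coeff ?p i) + cmod (of_nat (Suc i) * coeff ?p (Suc i))"
    by (simp only: exp_deriv_poly.simps coeff_add coeff_smult coeff_pderiv norm_triangle_ineq)
  ultimately show ?case
    by (simp add: distrib_right)
qed

lemma exp_deriv_poly_bound: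
  assumes "0 \<le> u"
  shows "cmod (poly (exp_deriv_poly z k j) (of_real u)) \<le> real (Suc k) * (cmod z + real k) ^ j * (1 + u) ^ k"
proof -
  let ?p = "exp_deriv_poly z k j"
  have "poly ?p (of_real u) = (\<Sum>i\<le>k. coeff ?p i * of_real u ^ i)"
    unfolding poly_altdef using exp_deriv_poly_degree[of z k j]
    by (intro sum.mono_neutral_left) (auto simp: coeff_eq_0)
  also have "cmod \<dots> \<le> (\<Sum>i\<le>k. (cmod z + real k) ^ j * (1 + u) ^ k)"
  proof (rule sum_norm_le)
    fix i assume "i \<in> {..k}"
    then have "u ^ i \<le> (1 + u) ^ k"
      using assms by (intro order_trans[OF power_mono power_increasing]) auto
    then show "cmod (coeff ?p i * of_real u ^ i) \<le> (cmod z + real k) ^ j * (1 + u) ^ k"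
      unfolding norm_mult norm_power norm_of_real using assms
      by (intro mult_mono exp_deriv_poly_coeff_bound) auto
  qed
  finally show ?thesis by (simp add: mult_ac)
qed

text \<open>This is Taylor's formula at \<open>0\<close> with integral remainder. The Taylor
  polynomial of degree \<open>k\<close> of \<open>exp (u z) * u ^ k\<close> is \<open>u ^ k\<close>
  alone, so the remainder is exactly the stated difference.\<close>

lemma exp_power_taylor:
  assumes "0 \<le> d"
  shows "((\<lambda>u. ((d - u) ^ k / fact k) *\<^sub>R (exp (of_real u * z) * poly (exp_deriv_poly z k (Suc k)) (of_real u)))
    has_integral (exp (of_real d * z) * of_real d ^ k - of_real d ^ k)) {0..d}"
proof -
  define Df where "Df j u = exp (of_real u * z) * poly (exp_deriv_poly z k j) (of_real u)" for j and u :: real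
  have "((\<lambda>u. ((d - u) ^ (Suc k - 1) / fact (Suc k - 1)) *\<^sub>R Df (Suc k) u)
    has_integral (Df 0 d - (\<Sum>i<Suc k. ((d - 0) ^ i / fact i) *\<^sub>R Df i 0))) {0..d}"
  proof (rule Taylor_has_integral)
    fix j and t :: real
    have "((\<lambda>w. exp (w * z) * poly (exp_deriv_poly z k j) w) has_field_derivative
        exp (of_real t * z) * poly (exp_deriv_poly z k (Suc j)) (of_real t)) (at (of_real t))"
      by (auto intro!: derivative_eq_intros poly_DERIV simp: algebra_simps)
    then show "(Df j has_vector_derivative Df (Suc j) t) (at t within {0..d})"
      unfolding Df_def by (rule has_vector_derivative_real_field)
  qed (use assms in auto)
  moreover have "(\<Sum>i<Suc k. ((d - 0) ^ i / fact i) *\<^sub>R Df i 0) = of_real d ^ k"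
  proof -
    have "Df i 0 = 0" if "i < k" for i
      using exp_deriv_poly_low_coeff[of 0 i k z] that by (simp add: Df_def poly_0_coeff_0)
    moreover have "Df k 0 = fact k"
      using exp_deriv_poly_low_coeff[of 0 k k z] by (simp add: Df_def poly_0_coeff_0)
    ultimately show ?thesis
      by (simp add: scaleR_conv_of_real)
  qed
  moreover have "Df 0 d = exp (of_real d * z) * of_real d ^ k"
    by (simp add: Df_def poly_monom)
  ultimately show ?thesis
    by (simp add: Df_def)
qed

lemma riesz_mean_nat:
  assumes "frequency lam"
  shows "of_real x ^ k * riesz_mean lam a (real k) x s
    = (\<Sum>n | lam n < x. a n * exp (- of_real (lam n) * s) * of_real (x - lam n) ^ k)"
  unfolding riesz_mean_def sum_distrib_left
proof (intro sum.cong refl)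
  fix n assume "n \<in> {n. lam n < x}"
  then have n: "lam n < x" "0 < x"
    using frequency_nonneg[OF assms, of n] by auto
  have "x ^ k * (1 - lam n / x) powr real k = (x * (1 - lam n / x)) ^ k"
    using n by (simp add: powr_realpow power_mult_distrib)
  also have "x * (1 - lam n / x) = x - lam n"
    using n by (simp add: right_diff_distrib)
  finally have "of_real x ^ k * of_real ((1 - lam n / x) powr real k) = (of_real (x - lam n) ^ k :: complex)"
    by (metis of_real_mult of_real_power)
  then show "of_real x ^ k * (a n * exp (- of_real (lam n) * s) * of_real ((1 - lam n / x) powr real k))
      = a n * exp (- of_real (lam n) * s) * of_real (x - lam n) ^ k"
    by (metis mult.assoc mult.commute)
qed

text \<open>A single term of the series of \<open>exp (v / 2)\<close> dominates the power; half of
  the decay is spent on it, and the other half remains for integration.\<close>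

lemma power_exp_le: "0 \<le> v \<Longrightarrow> v ^ k * exp (- v) \<le> fact k * 2 ^ k * exp (- v / 2)" for v :: real
proof -
  assume v: "0 \<le> v"
  have "(v / 2) ^ k / fact k \<le> exp (v / 2)"
  proof -
    have 1: "(\<lambda>i. (v / 2) ^ i / fact i) sums exp (v / 2)"
      using exp_converges[of "v / 2"] by (simp only: real_scaleR_def divide_real_def mult.commute)
    have "(v / 2) ^ k / fact k \<le> (\<Sum>i. (v / 2) ^ i / fact i)"
      using v sum_le_suminf[OF sums_summable[OF 1], of "{k}"] by simp
    then show ?thesis
      using sums_unique[OF 1] by simp
  qed
  then have "v ^ k \<le> fact k * 2 ^ k * exp (v / 2)"
    by (simp add: power_divide pos_divide_le_eq mult_ac)
  then have "v ^ k * exp (- v) \<le> fact k * 2 ^ k * exp (v / 2) * exp (- v)"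
    by (rule mult_right_mono) simp
  also have "\<dots> = fact k * 2 ^ k * exp (- v / 2)"
    unfolding mult.assoc exp_add[symmetric] by simp
  finally show ?thesis .
qed

text \<open>This is \<open>k + 1\<close>-fold summation by parts, carried out term by term through Taylor's formula.\<close>

lemma riesz_mean_shift_integral:
  assumes freq: "frequency lam" and "0 \<le> x"
  shows "((\<lambda>u. (of_real (x - u) ^ k * riesz_mean lam a (real k) (x - u) s0 / fact k)
        * (exp (of_real u * z) * poly (exp_deriv_poly z k (Suc k)) (of_real u)))
    has_integral (exp (of_real x * z) * (of_real x ^ k * riesz_mean lam a (real k) x (s0 + z))
       - of_real x ^ k * riesz_mean lam a (real k) x s0)) {0..x}"
proof -
  let ?c = "\<lambda>n. a n * exp (- of_real (lam n) * s0)"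
  let ?H = "\<lambda>u. exp (of_real u * z) * poly (exp_deriv_poly z k (Suc k)) (of_real u)"
  define F where "F = {n. lam n < x}"
  have F: "finite F"
    unfolding F_def by (rule frequency_finite[OF freq])
  let ?g = "\<lambda>n u. if u \<in> {0..x - lam n} then ((x - lam n - u) ^ k / fact k) *\<^sub>R ?H u else 0"
  have "(?g n has_integral (exp (of_real (x - lam n) * z) * of_real (x - lam n) ^ k - of_real (x - lam n) ^ k)) {0..x}"
    if "n \<in> F" for n
  proof -
    have "{0..x - lam n} \<subseteq> {0..x}"
      using frequency_nonneg[OF freq, of n] by auto
    then show ?thesis
      using exp_power_taylor[of "x - lam n" k z] that by (subst has_integral_restrict) (auto simp: F_def)
  qed
  then have "((\<lambda>u. \<Sum>n\<in>F. ?c n * ?g n u) has_integral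
     (\<Sum>n\<in>F. ?c n * (exp (of_real (x - lam n) * z) * of_real (x - lam n) ^ k - of_real (x - lam n) ^ k))) {0..x}"
    using F by (intro has_integral_sum has_integral_mult_right)
  \<comment> \<open>The factor \<open>exp ((x - lam n) * z)\<close> splits into
    \<open>exp (x * z)\<close>, common to all terms, and \<open>exp (- lam n * z)\<close>, which
    shifts \<open>s0\<close> to \<open>s0 + z\<close>.\<close>
  moreover have "(\<Sum>n\<in>F. ?c n * (exp (of_real (x - lam n) * z) * of_real (x - lam n) ^ k - of_real (x - lam n) ^ k))
     = exp (of_real x * z) * (of_real x ^ k * riesz_mean lam a (real k) x (s0 + z))
       - of_real x ^ k * riesz_mean lam a (real k) x s0"
    unfolding riesz_mean_nat[OF freq] F_def[symmetric] sum_distrib_left sum_subtractf[symmetric]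
    by (intro sum.cong refl) (simp add: algebra_simps exp_add exp_diff exp_minus divide_inverse)
  ultimately have int: "((\<lambda>u. \<Sum>n\<in>F. ?c n * ?g n u) has_integral
      exp (of_real x * z) * (of_real x ^ k * riesz_mean lam a (real k) x (s0 + z))
       - of_real x ^ k * riesz_mean lam a (real k) x s0) {0..x}"
    by simp
  show ?thesis
  \<comment> \<open>At \<open>u = x - lam n\<close> the closed interval in \<open>?g\<close> and the
    strict condition in the Riesz mean disagree, visibly for \<open>k = 0\<close>, where
    \<open>0 ^ 0 = 1\<close>. These finitely many points are discarded.\<close>
  proof (rule has_integral_spike_finite[OF _ _ int])
    show "finite ((\<lambda>n. x - lam n) ` F)"
      using F by simp
    fix u assume u: "u \<in> {0..x} - (\<lambda>n. x - lam n) ` F"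
    have "{n. lam n < x - u} = {n \<in> F. lam n < x - u}"
      using u by (auto simp: F_def)
    then have "of_real (x - u) ^ k * riesz_mean lam a (real k) (x - u) s0
        = (\<Sum>n\<in>F. if lam n < x - u then ?c n * of_real (x - u - lam n) ^ k else 0)"
      unfolding riesz_mean_nat[OF freq] using F by (simp only: sum.inter_filter)
    then have "(of_real (x - u) ^ k * riesz_mean lam a (real k) (x - u) s0 / fact k) * ?H u
        = (\<Sum>n\<in>F. (if lam n < x - u then ?c n * of_real (x - u - lam n) ^ k else 0) / fact k * ?H u)"
      by (simp only: sum_divide_distrib sum_distrib_right)
    also have "\<dots> = (\<Sum>n\<in>F. ?c n * ?g n u)"
    proof (rule sum.cong[OF refl])
      fix n assume n: "n \<in> F"
      have 1: "of_real (x - u - lam n) = (of_real (x - lam n - u) :: complex)"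
        by simp
      have 2: "(u \<in> {0..x - lam n}) = (lam n < x - u)"
        using u n by force
      show "(if lam n < x - u then ?c n * of_real (x - u - lam n) ^ k else 0) / fact k * ?H u = ?c n * ?g n u"
        unfolding 1 2 by (simp add: scaleR_conv_of_real)
    qed
    finally show "(of_real (x - u) ^ k * riesz_mean lam a (real k) (x - u) s0 / fact k) * ?H u = (\<Sum>n\<in>F. ?c n * ?g n u)" .
  qed
qed

lemma has_integral_exp_half:
  fixes x :: real
  assumes "0 \<le> x"
  shows "((\<lambda>u. exp (- (x - u) / 2)) has_integral (2 - 2 * exp (- x / 2))) {0..x}"
proof -
  have "((\<lambda>u. exp (- (x - u) / 2)) has_integral (2 * exp (- (x - x) / 2) - 2 * exp (- (x - 0) / 2))) {0..x}"
    by (rule fundamental_theorem_of_calculus[OF assms])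
       (auto intro!: derivative_eq_intros simp flip: has_real_derivative_iff_has_vector_derivative)
  then show ?thesis by simp
qed

text \<open>In the Taylor integral \<open>exp (u * Re z)\<close> is \<open>exp (x * Re z)\<close>
  times \<open>exp (- (x - u) * Re z)\<close>. The first factor cancels against the one in front of
  the shifted mean. As \<open>Re z \<ge> 1\<close>, the second absorbs \<open>(x - u) ^ k\<close>
  and leaves \<open>exp (- (x - u) / 2)\<close>, whose integral is at most \<open>2\<close> for
  every \<open>x\<close>. What remains is the polynomial dependence on \<open>z\<close> from
  \<open>exp_deriv_poly_bound\<close>.\<close>

lemma riesz_mean_polynomial_bound:
  assumes freq: "frequency lam" and M: "\<And>x. cmod (riesz_mean lam a (real k) x s0) \<le> M"
  obtains B where "\<And>x s. 1 \<le> x \<Longrightarrow> Re s0 + 1 \<le> Re s \<Longrightarrow>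
    cmod (riesz_mean lam a (real k) x s) \<le> B * (1 + cmod s) ^ Suc k"
proof -
  have "0 \<le> M"
    using M[of 0] norm_ge_zero order_trans by blast
  \<comment> \<open>The factor \<open>real (Suc k)\<close> comes from
    \<open>exp_deriv_poly_bound\<close>, one \<open>2 ^ k\<close> from
    \<open>1 + u \<le> 2 * x\<close>, and the other from \<open>power_exp_le\<close>, whose
    \<open>fact k\<close> cancels the one in the Taylor remainder.\<close>
  define K where "K = M * real (Suc k) * 2 ^ k * 2 ^ k"
  have "0 \<le> K"
    using \<open>0 \<le> M\<close> by (simp add: K_def)
  define L where "L = cmod s0 + real k + 1"
  have "cmod (riesz_mean lam a (real k) x s) \<le> (M + 2 * K * L ^ Suc k) * (1 + cmod s) ^ Suc k"
    if x: "1 \<le> x" and s: "Re s0 + 1 \<le> Re s" for x s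
  proof -
    define z where "z = s - s0"
    have z: "1 \<le> Re z" "s = s0 + z"
      using s by (auto simp: z_def)
    define Z where "Z = (cmod z + real k) ^ Suc k"
    let ?H = "\<lambda>u. exp (of_real u * z) * poly (exp_deriv_poly z k (Suc k)) (of_real u)"
    let ?f = "\<lambda>u. (of_real (x - u) ^ k * riesz_mean lam a (real k) (x - u) s0 / fact k) * ?H u"
    let ?I = "exp (of_real x * z) * (of_real x ^ k * riesz_mean lam a (real k) x s) - of_real x ^ k * riesz_mean lam a (real k) x s0"
    let ?E = "exp (x * Re z)"
    have int: "(?f has_integral ?I) {0..x}"
      unfolding z(2) using x by (intro riesz_mean_shift_integral[OF freq]) auto
    have bound: "cmod (?f u) \<le> ?E * x ^ k * K * Z * exp (- (x - u) / 2)" if u: "u \<in> {0..x}" for u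
    proof -
      have "cmod (?f u) = ((x - u) ^ k * cmod (riesz_mean lam a (real k) (x - u) s0) / fact k)
         * (exp (u * Re z) * cmod (poly (exp_deriv_poly z k (Suc k)) (of_real u)))"
        using u by (simp add: norm_mult norm_divide norm_power flip: of_real_diff)
      also have "\<dots> \<le> ((x - u) ^ k * M / fact k) * (exp (u * Re z) * (real (Suc k) * Z * (1 + u) ^ k))"
        unfolding Z_def using u \<open>0 \<le> M\<close>
        by (intro mult_mono divide_right_mono mult_left_mono M exp_deriv_poly_bound) auto
      also have "\<dots> \<le> ((x - u) ^ k * M / fact k) * (exp (u * Re z) * (real (Suc k) * Z * (2 * x) ^ k))"
        unfolding Z_def using u x \<open>0 \<le> M\<close>
        by (intro mult_left_mono power_mono) auto
      also have "\<dots> = ?E * x ^ k * M * real (Suc k) * 2 ^ k * Z * ((x - u) ^ k * exp (- ((x - u) * Re z)) / fact k)"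
      proof -
        have "exp (u * Re z) = ?E * exp (- ((x - u) * Re z))"
          by (simp add: algebra_simps flip: exp_add)
        then show ?thesis by (simp add: power_mult_distrib)
      qed
      also have "\<dots> \<le> ?E * x ^ k * M * real (Suc k) * 2 ^ k * Z * (2 ^ k * exp (- (x - u) / 2))"
      proof (intro mult_left_mono)
        have "(x - u) * 1 \<le> (x - u) * Re z"
          using u z(1) by (intro mult_left_mono) auto
        then have "(x - u) ^ k * exp (- ((x - u) * Re z)) \<le> (x - u) ^ k * exp (- (x - u))"
          using u by (intro mult_left_mono) auto
        also have "\<dots> \<le> fact k * 2 ^ k * exp (- (x - u) / 2)"
          using u by (intro power_exp_le) auto
        finally show "(x - u) ^ k * exp (- ((x - u) * Re z)) / fact k \<le> 2 ^ k * exp (- (x - u) / 2)"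
          by (subst pos_divide_le_eq) (simp_all add: mult_ac)
      qed (use x \<open>0 \<le> M\<close> in \<open>auto simp: Z_def\<close>)
      also have "\<dots> = ?E * x ^ k * K * Z * exp (- (x - u) / 2)"
        by (simp add: K_def mult_ac)
      finally show ?thesis .
    qed
    have hi: "((\<lambda>u. ?E * x ^ k * K * Z * exp (- (x - u) / 2)) has_integral
        ?E * x ^ k * K * Z * (2 - 2 * exp (- x / 2))) {0..x}"
      using x by (intro has_integral_mult_right has_integral_exp_half) auto
    have "cmod (integral {0..x} ?f) \<le> integral {0..x} (\<lambda>u. ?E * x ^ k * K * Z * exp (- (x - u) / 2))"
      by (rule integral_norm_bound_integral[OF has_integral_integrable[OF int] has_integral_integrable[OF hi] bound])
    then have "cmod ?I \<le> ?E * x ^ k * K * Z * (2 - 2 * exp (- x / 2))"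
      by (simp only: integral_unique[OF int] integral_unique[OF hi])
    also have "\<dots> \<le> ?E * x ^ k * K * Z * 2"
      using x \<open>0 \<le> K\<close> by (intro mult_left_mono) (auto simp: Z_def)
    finally have I: "cmod ?I \<le> ?E * x ^ k * (2 * K * Z)"
      by (simp add: mult_ac)
    have "?E * x ^ k * cmod (riesz_mean lam a (real k) x s)
        = cmod (exp (of_real x * z) * (of_real x ^ k * riesz_mean lam a (real k) x s))"
      using x by (simp add: norm_mult norm_power)
    also have "\<dots> \<le> cmod ?I + cmod (of_real x ^ k * riesz_mean lam a (real k) x s0)"
      by (metis diff_add_cancel norm_triangle_ineq)
    also have "cmod (of_real x ^ k * riesz_mean lam a (real k) x s0) \<le> x ^ k * M"
      using x M by (simp add: norm_mult norm_power mult_left_mono)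
    also have "\<dots> \<le> ?E * x ^ k * M"
      using x z(1) \<open>0 \<le> M\<close> by (intro mult_right_mono) auto
    finally have "?E * x ^ k * cmod (riesz_mean lam a (real k) x s) \<le> ?E * x ^ k * (M + 2 * K * Z)"
      using I by (simp add: distrib_left)
    then have *: "cmod (riesz_mean lam a (real k) x s) \<le> M + 2 * K * Z"
      using x by (subst (asm) mult_le_cancel_left_pos) auto
    have "cmod z + real k \<le> cmod s + cmod s0 + real k"
      unfolding z_def using norm_triangle_ineq4[of s s0] by simp
    also have "\<dots> \<le> L * (1 + cmod s)"
      by (simp add: L_def algebra_simps)
    finally have "Z \<le> (L * (1 + cmod s)) ^ Suc k"
      unfolding Z_def by (intro power_mono) auto
    then have "2 * K * Z \<le> 2 * K * (L ^ Suc k * (1 + cmod s) ^ Suc k)"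
      unfolding power_mult_distrib using \<open>0 \<le> K\<close> by (intro mult_left_mono) auto
    moreover have "M * 1 \<le> M * (1 + cmod s) ^ Suc k"
      using \<open>0 \<le> M\<close> by (intro mult_left_mono one_le_power) auto
    ultimately show ?thesis
      using * by (simp only: distrib_right mult.assoc)
  qed
  then show ?thesis by (rule that)
qed

subsection \<open>Perron's formula\<close>

text \<open>Each exponential moves the argument of the kernel from \<open>y\<close> to
  \<open>y - lam n\<close>, where \<open>bromwich_one_pos\<close> and
  \<open>bromwich_one_nonpos\<close> evaluate it.\<close>

lemma bromwich_dirichlet_polynomial:
  assumes "finite F" "2 \<le> p" "0 < c"
  shows "bromwich p (\<lambda>s. \<Sum>n\<in>F. b n * exp (- of_real (lam n) * s)) y c
    = bromwich p (\<lambda>_. 1) 1 1 * (\<Sum>n\<in>F. if lam n < y then b n * of_real (y - lam n) ^ (p - 1) else 0)"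
proof -
  let ?K = "\<lambda>u t. 1 * exp (of_real u * Complex c t) / Complex c t ^ p"
  have int: "integrable lborel (?K u)" for u
    by (rule bromwich_integrable[where a = 0 and N = 0 and B = 1]) (use assms in auto)
  have eq: "(\<Sum>n\<in>F. b n * exp (- of_real (lam n) * s)) * exp (of_real y * s) / s ^ p
      = (\<Sum>n\<in>F. b n * (1 * exp (of_real (y - lam n) * s) / s ^ p))" for s
  proof -
    have "exp (of_real (y - lam n) * s) = exp (- of_real (lam n) * s) * exp (of_real y * s)" for n
      by (simp add: algebra_simps flip: exp_add)
    then show ?thesis
      by (simp add: sum_distrib_right sum_divide_distrib mult.assoc)
  qed
  have "bromwich p (\<lambda>s. \<Sum>n\<in>F. b n * exp (- of_real (lam n) * s)) y c
      = (\<Sum>n\<in>F. b n * bromwich p (\<lambda>_. 1) (y - lam n) c)"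
    unfolding bromwich_def eq
    by (subst Bochner_Integration.integral_sum) (simp_all only: integrable_mult_right int integral_mult_right_zero)
  also have "\<dots> = bromwich p (\<lambda>_. 1) 1 1 * (\<Sum>n\<in>F. if lam n < y then b n * of_real (y - lam n) ^ (p - 1) else 0)"
    unfolding sum_distrib_left
  proof (rule sum.cong[OF refl])
    fix n
    show "b n * bromwich p (\<lambda>_. 1) (y - lam n) c
      = bromwich p (\<lambda>_. 1) 1 1 * (if lam n < y then b n * of_real (y - lam n) ^ (p - 1) else 0)"
    proof (cases "lam n < y")
      case True
      then show ?thesis
        using bromwich_one_pos[OF assms(2) _ assms(3), of "y - lam n"] by (simp add: mult_ac)
    next
      case False
      then show ?thesis
        using bromwich_one_nonpos[OF assms(2) _ assms(3), of "y - lam n"] by simp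
    qed
  qed
  finally show ?thesis .
qed

lemma bromwich_tendsto:
  assumes hol: "\<And>j. g j holomorphic_on {s. a < Re s}" "f holomorphic_on {s. a < Re s}" "0 \<le> a" "a < c"
    and p: "N + 2 \<le> p"
    and bound: "\<And>j t. cmod (g j (Complex c t)) \<le> B * (1 + cmod (Complex c t)) ^ N"
    and lim: "\<And>t. (\<lambda>j. g j (Complex c t)) \<longlonglongrightarrow> f (Complex c t)"
  shows "(\<lambda>j. bromwich p (g j) y c) \<longlonglongrightarrow> bromwich p f y c"
  unfolding bromwich_def
proof (rule integral_dominated_convergence[where w = "\<lambda>t. B * (1 + 1 / c) ^ p * exp (y * c) / (1 + t\<^sup>2)"])
  have nz: "Complex c t ^ p \<noteq> 0" for t
    using hol(3,4) by (intro power_not_zero) (simp add: complex_eq_iff)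
  show "AE t in lborel. (\<lambda>j. g j (Complex c t) * exp (of_real y * Complex c t) / Complex c t ^ p)
      \<longlonglongrightarrow> f (Complex c t) * exp (of_real y * Complex c t) / Complex c t ^ p"
    by (intro AE_I2 tendsto_intros lim nz)
  show "AE t in lborel. norm (g j (Complex c t) * exp (of_real y * Complex c t) / Complex c t ^ p)
      \<le> B * (1 + 1 / c) ^ p * exp (y * c) / (1 + t\<^sup>2)" for j
  proof (rule AE_I2)
    fix t
    show "norm (g j (Complex c t) * exp (of_real y * Complex c t) / Complex c t ^ p)
      \<le> B * (1 + 1 / c) ^ p * exp (y * c) / (1 + t\<^sup>2)"
      using bromwich_kernel_bound[of c "Complex c t" N p "g j" B y] hol(3,4) p bound by simp
  qed
qed (intro bromwich_integrand_measurable[OF hol(2-4)] bromwich_integrand_measurable[OF hol(1,3,4)]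
      integrable_Cauchy_density)+

lemma riesz_mean_holomorphic: "riesz_mean lam a m x holomorphic_on S"
  unfolding riesz_mean_def[abs_def] by (intro holomorphic_intros)

definition riesz_sum :: "(nat \<Rightarrow> real) \<Rightarrow> (nat \<Rightarrow> complex) \<Rightarrow> nat \<Rightarrow> real \<Rightarrow> complex" where
  "riesz_sum lam a k y = (\<Sum>n | lam n < y. a n * of_real (y - lam n) ^ k)"

text \<open>Because \<open>y \<le> x\<close>, the truncation of the mean at \<open>x\<close> loses
  no frequency below \<open>y\<close>.\<close>

lemma bromwich_riesz_mean:
  assumes freq: "frequency lam" and "2 \<le> p" "0 < c" "y \<le> x"
  shows "bromwich p (riesz_mean lam a m x) y c = bromwich p (\<lambda>_. 1) 1 1 *
    riesz_sum lam (\<lambda>n. a n * of_real ((1 - lam n / x) powr m)) (p - 1) y"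
proof -
  define b where "b n = a n * of_real ((1 - lam n / x) powr m)" for n
  have F: "finite {n. lam n < x}"
    by (rule frequency_finite[OF freq])
  have "riesz_mean lam a m x = (\<lambda>s. \<Sum>n | lam n < x. b n * exp (- of_real (lam n) * s))"
    by (simp add: riesz_mean_def b_def mult_ac fun_eq_iff)
  then have "bromwich p (riesz_mean lam a m x) y c = bromwich p (\<lambda>_. 1) 1 1 *
      (\<Sum>n | lam n < x. if lam n < y then b n * of_real (y - lam n) ^ (p - 1) else 0)"
    by (simp only: bromwich_dirichlet_polynomial[OF F assms(2,3)])
  also have "(\<Sum>n | lam n < x. if lam n < y then b n * of_real (y - lam n) ^ (p - 1) else 0)
      = riesz_sum lam b (p - 1) y"
  proof -
    have "{n. lam n < y} = {n \<in> {n. lam n < x}. lam n < y}"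
      using \<open>y \<le> x\<close> by auto
    then show ?thesis
      unfolding riesz_sum_def using F by (simp only: sum.inter_filter)
  qed
  finally show ?thesis by (simp only: b_def[abs_def])
qed

lemma perron_high_order:
  assumes freq: "frequency lam" and hol: "f holomorphic_on {s. 0 < Re s}" and "0 \<le> \<sigma>"
    and lim: "\<And>s. \<sigma> < Re s \<Longrightarrow> ((\<lambda>x. riesz_mean lam a (real k) x s) \<longlongrightarrow> f s) at_top"
  shows "bromwich (k + 3) f y (\<sigma> + 2) = bromwich (k + 3) (\<lambda>_. 1) 1 1 * riesz_sum lam a (k + 2) y"
proof -
  \<comment> \<open>One unit to the right of \<open>\<sigma>\<close> gives a point of convergence,
    and one more is required by \<open>riesz_mean_polynomial_bound\<close>; hence the abscissa
    \<open>\<sigma> + 2\<close>. The growth exponent \<open>Suc k\<close> found there leads to the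
    order \<open>k + 3\<close>.\<close>
  define s0 :: complex where "s0 = of_real (\<sigma> + 1)"
  obtain M where "\<And>x. cmod (riesz_mean lam a (real k) x s0) \<le> M"
    using riesz_mean_bounded[OF freq _ lim[of s0]] by (auto simp: s0_def)
  then obtain B where B: "\<And>x s. 1 \<le> x \<Longrightarrow> Re s0 + 1 \<le> Re s \<Longrightarrow>
    cmod (riesz_mean lam a (real k) x s) \<le> B * (1 + cmod s) ^ Suc k"
    using riesz_mean_polynomial_bound[OF freq] by blast
  \<comment> \<open>The polynomial bound asks for \<open>X j \<ge> 1\<close>, and
    \<open>bromwich_riesz_mean\<close> for \<open>X j \<ge> y\<close>.\<close>
  define X where "X j = real j + max 1 y" for j
  have X: "1 \<le> X j" "y \<le> X j" for j
    by (auto simp: X_def)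
  have Xlim: "filterlim X at_top sequentially"
    unfolding X_def by real_asymp
  have "(\<lambda>j. bromwich (k + 3) (riesz_mean lam a (real k) (X j)) y (\<sigma> + 2)) \<longlonglongrightarrow> bromwich (k + 3) f y (\<sigma> + 2)"
  proof (rule bromwich_tendsto[OF riesz_mean_holomorphic hol, where N = "Suc k" and B = B])
    show "cmod (riesz_mean lam a (real k) (X j) (Complex (\<sigma> + 2) t)) \<le> B * (1 + cmod (Complex (\<sigma> + 2) t)) ^ Suc k" for j t
      by (rule B) (use X in \<open>auto simp: s0_def\<close>)
    show "(\<lambda>j. riesz_mean lam a (real k) (X j) (Complex (\<sigma> + 2) t)) \<longlonglongrightarrow> f (Complex (\<sigma> + 2) t)" for t
      by (rule filterlim_compose[OF lim Xlim]) simp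
  qed (use \<open>0 \<le> \<sigma>\<close> in auto)
  moreover have "(\<lambda>j. bromwich (k + 3) (riesz_mean lam a (real k) (X j)) y (\<sigma> + 2))
      \<longlonglongrightarrow> bromwich (k + 3) (\<lambda>_. 1) 1 1 * riesz_sum lam a (k + 2) y"
  proof -
    have eq: "bromwich (k + 3) (riesz_mean lam a (real k) (X j)) y (\<sigma> + 2) = bromwich (k + 3) (\<lambda>_. 1) 1 1 *
        (\<Sum>n | lam n < y. a n * of_real ((1 - lam n / X j) powr real k) * of_real (y - lam n) ^ (k + 2))" for j
      using bromwich_riesz_mean[OF freq, of "k + 3" "\<sigma> + 2" y "X j"] X \<open>0 \<le> \<sigma>\<close> by (simp add: riesz_sum_def)
    have "(\<lambda>j. (1 - lam n / X j) powr real k) \<longlonglongrightarrow> (1 - 0) powr real k" for n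
      by (intro tendsto_intros tendsto_divide_0 filterlim_at_top_imp_at_infinity[OF Xlim]) auto
    then have "(\<lambda>j. of_real ((1 - lam n / X j) powr real k) :: complex) \<longlonglongrightarrow> of_real 1" for n
      by (intro tendsto_of_real) simp
    then have "(\<lambda>j. bromwich (k + 3) (\<lambda>_. 1) 1 1 *
        (\<Sum>n | lam n < y. a n * of_real ((1 - lam n / X j) powr real k) * of_real (y - lam n) ^ (k + 2)))
      \<longlonglongrightarrow> bromwich (k + 3) (\<lambda>_. 1) 1 1 * (\<Sum>n | lam n < y. a n * of_real 1 * of_real (y - lam n) ^ (k + 2))"
      by (intro tendsto_mult tendsto_sum tendsto_const)
    then show ?thesis
      unfolding eq by (simp add: riesz_sum_def)
  qed
  ultimately show ?thesis
    using LIMSEQ_unique by blast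
qed

text \<open>A small negative increment keeps the finite index set \<open>lam n < y\<close>, so only
  finitely many powers are differentiated. At \<open>y = lam n\<close> a positive increment would
  bring in the index \<open>n\<close> at once.\<close>

lemma riesz_sum_left_derivative:
  assumes freq: "frequency lam"
  defines "h \<equiv> \<lambda>n. - inverse (real (Suc n))"
  shows "(\<lambda>j. (riesz_sum lam a (Suc k) (y + h j) - riesz_sum lam a (Suc k) y) / of_real (h j))
    \<longlonglongrightarrow> of_nat (Suc k) * riesz_sum lam a k y"
proof -
  define F where "F = {n. lam n < y}"
  have F: "finite F"
    unfolding F_def by (rule frequency_finite[OF freq])
  have h0: "h \<longlonglongrightarrow> -0"
    unfolding h_def by (intro tendsto_intros LIMSEQ_inverse_real_of_nat)
  have hf: "filterlim (\<lambda>n. of_real (h n) :: complex) (at 0) sequentially"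
    using tendsto_of_real[OF h0, where ?'a = complex] by (intro filterlim_atI) (auto simp: h_def simp del: of_nat_Suc)
  have 1: "(\<lambda>j. ((w + of_real (h j)) ^ Suc k - w ^ Suc k) / of_real (h j)) \<longlonglongrightarrow> of_nat (Suc k) * w ^ k" for w :: complex
  proof -
    have "((\<lambda>z. z ^ Suc k) has_field_derivative of_nat (Suc k) * w ^ k) (at w)"
      by (auto intro!: derivative_eq_intros simp del: power_Suc)
    then show ?thesis
      by (rule filterlim_compose[OF DERIV_D hf])
  qed
  have "(\<lambda>j. \<Sum>n\<in>F. a n * (((of_real (y - lam n) + of_real (h j)) ^ Suc k - of_real (y - lam n) ^ Suc k) / of_real (h j)))
    \<longlonglongrightarrow> (\<Sum>n\<in>F. a n * (of_nat (Suc k) * of_real (y - lam n) ^ k))"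
    by (intro tendsto_sum tendsto_mult_left 1)
  also have "(\<Sum>n\<in>F. a n * (of_nat (Suc k) * of_real (y - lam n) ^ k)) = of_nat (Suc k) * riesz_sum lam a k y"
    by (simp only: riesz_sum_def F_def sum_distrib_left mult.left_commute)
  finally have 2: "(\<lambda>j. \<Sum>n\<in>F. a n * (((of_real (y - lam n) + of_real (h j)) ^ Suc k - of_real (y - lam n) ^ Suc k) / of_real (h j)))
    \<longlonglongrightarrow> of_nat (Suc k) * riesz_sum lam a k y" .
  have "\<forall>\<^sub>F j in sequentially. \<forall>n\<in>F. lam n < y + h j"
  proof (intro eventually_ball_finite F ballI)
    fix n assume "n \<in> F"
    have "(\<lambda>j. y + h j) \<longlonglongrightarrow> y + -0"
      by (intro tendsto_intros h0)
    then show "\<forall>\<^sub>F j in sequentially. lam n < y + h j"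
      using \<open>n \<in> F\<close> by (intro order_tendstoD(1)) (auto simp: F_def)
  qed
  then have "\<forall>\<^sub>F j in sequentially. (\<Sum>n\<in>F. a n * (((of_real (y - lam n) + of_real (h j)) ^ Suc k - of_real (y - lam n) ^ Suc k) / of_real (h j)))
     = (riesz_sum lam a (Suc k) (y + h j) - riesz_sum lam a (Suc k) y) / of_real (h j)"
  proof eventually_elim
    case (elim j)
    have "h j < 0" by (simp add: h_def)
    then have "{n. lam n < y + h j} = F"
      using elim by (force simp: F_def)
    then have "riesz_sum lam a (Suc k) (y + h j) - riesz_sum lam a (Suc k) y
       = (\<Sum>n\<in>F. a n * ((of_real (y + h j - lam n)) ^ Suc k - of_real (y - lam n) ^ Suc k))"
      by (simp only: riesz_sum_def F_def[symmetric] sum_subtractf[symmetric] right_diff_distrib)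
    moreover have "of_real (y + h j - lam n) = (of_real (y - lam n) + of_real (h j) :: complex)" for n
      by simp
    ultimately show ?case
      by (simp only: sum_divide_distrib times_divide_eq_right)
  qed
  with 2 show ?thesis
    by (rule Lim_transform_eventually)
qed

text \<open>Both sides are differentiated from the left in \<open>y\<close>. By
  \<open>bromwich_const_rec\<close>, the factor \<open>p\<close> produced by the Riesz sum turns the
  constant of order \<open>Suc p\<close> into that of order \<open>p\<close>.\<close>

lemma perron_lower_order:
  assumes freq: "frequency lam" and hol: "f holomorphic_on {s. 0 < Re s}" "0 < c" and p: "N + 2 \<le> p"
    and bound: "\<And>t. cmod (f (Complex c t)) \<le> B * (1 + cmod (Complex c t)) ^ N"
    and perron: "\<And>y. bromwich (Suc p) f y c = bromwich (Suc p) (\<lambda>_. 1) 1 1 * riesz_sum lam a p y"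
  shows "bromwich p f y c = bromwich p (\<lambda>_. 1) 1 1 * riesz_sum lam a (p - 1) y"
proof -
  define h where "h n = - inverse (real (Suc n))" for n
  let ?C = "bromwich (Suc p) (\<lambda>_. 1) 1 1"
  have "(\<lambda>j. (bromwich (Suc p) f (y + h j) c - bromwich (Suc p) f y c) / of_real (h j)) \<longlonglongrightarrow> bromwich p f y c"
    unfolding h_def by (rule bromwich_left_derivative[OF hol(1) order_refl hol(2) p bound])
  moreover have "(\<lambda>j. ?C * ((riesz_sum lam a p (y + h j) - riesz_sum lam a p y) / of_real (h j)))
      \<longlonglongrightarrow> ?C * (of_nat p * riesz_sum lam a (p - 1) y)"
    using riesz_sum_left_derivative[OF freq, of a "p - 1" y] p
    unfolding h_def by (intro tendsto_mult_left) simp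
  moreover have "(bromwich (Suc p) f (y + h j) c - bromwich (Suc p) f y c) / of_real (h j)
      = ?C * ((riesz_sum lam a p (y + h j) - riesz_sum lam a p y) / of_real (h j))" for j
    by (simp only: perron right_diff_distrib diff_divide_distrib times_divide_eq_right)
  ultimately have "bromwich p f y c = ?C * (of_nat p * riesz_sum lam a (p - 1) y)"
    using LIMSEQ_unique by (simp only:)
  moreover have "bromwich p (\<lambda>_. 1) 1 1 = of_nat p * ?C"
    using p by (intro bromwich_const_rec) simp
  ultimately show ?thesis
    by (simp only: mult_ac)
qed

text \<open>Perron's formula; its order \<open>N + 2\<close> is governed by the growth of \<open>f\<close> alone, not by the
  order of the Riesz means of the germ.\<close>

lemma perron_formula:
  assumes freq: "frequency lam" and hol: "f holomorphic_on {s. 0 < Re s}"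
    and bound: "\<And>s. 0 < Re s \<Longrightarrow> cmod (f s) \<le> B * (1 + cmod s) ^ N"
    and germ: "riesz_germ lam a f" and "0 < c"
  shows "bromwich (N + 2) f y c = bromwich (N + 2) (\<lambda>_. 1) 1 1 * riesz_sum lam a (N + 1) y"
proof -
  obtain m \<sigma> where m: "0 \<le> m" "0 \<le> \<sigma>"
    and lim: "\<And>s. \<sigma> < Re s \<Longrightarrow> ((\<lambda>x. riesz_mean lam a m x s) \<longlongrightarrow> f s) at_top"
    using germ by (auto simp: riesz_germ_def right_half_plane_def)
  \<comment> \<open>The order must be at least \<open>m + 1\<close> for
    \<open>riesz_mean_consistency\<close> and at least \<open>N\<close> for the descent to end at
    \<open>N + 1\<close>.\<close>
  define k where "k = N + nat \<lceil>m + 1\<rceil>"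
  have k: "m + 1 \<le> real k" "N + 2 \<le> k + 2"
    unfolding k_def by linarith+
  have "bromwich (k + 3) f y (\<sigma> + 2) = bromwich (k + 3) (\<lambda>_. 1) 1 1 * riesz_sum lam a (k + 2) y" for y
    by (intro perron_high_order freq hol m riesz_mean_consistency[OF freq m(1) k(1)] lim)
  then have high: "bromwich (Suc (k + 2)) f y (\<sigma> + 2) = bromwich (Suc (k + 2)) (\<lambda>_. 1) 1 1 * riesz_sum lam a (k + 2) y" for y
    by (simp add: numeral_3_eq_3)
  \<comment> \<open>The descent stays on one line. From here on the growth bound of \<open>f\<close>
    itself, rather than that of the Riesz means, makes the integrals converge, down to order
    \<open>N + 2\<close>.\<close>
  have "bromwich (Suc n) f y (\<sigma> + 2) = bromwich (Suc n) (\<lambda>_. 1) 1 1 * riesz_sum lam a n y"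
    if "n \<le> k + 2" "N + 1 \<le> n" for n y
    using that
  proof (induction n arbitrary: y rule: inc_induct)
    case base
    show ?case by (rule high)
  next
    case (step n)
    have "bromwich (Suc n) f y (\<sigma> + 2) = bromwich (Suc n) (\<lambda>_. 1) 1 1 * riesz_sum lam a (Suc n - 1) y"
      by (rule perron_lower_order[OF freq hol, where N = N and B = B]) (use step bound m in auto)
    then show ?case by simp
  qed
  from this[of "N + 1" y] have "bromwich (N + 2) f y (\<sigma> + 2) = bromwich (N + 2) (\<lambda>_. 1) 1 1 * riesz_sum lam a (N + 1) y"
    using k by simp
  moreover have "bromwich (N + 2) f y (\<sigma> + 2) = bromwich (N + 2) f y c"
    by (rule bromwich_shift[OF hol, where N = N and B = B]) (use m \<open>0 < c\<close> bound in auto)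
  ultimately show ?thesis by simp
qed

section \<open>Recovering the function from Perron's formula\<close>

text \<open>On the line \<open>Re s = 1 / x\<close> the substitution \<open>s = u / x\<close> turns the Perron integral of order \<open>p\<close>
  into \<open>x ^ (p - 1)\<close> times the integral of \<open>f (w + u / x) * exp u / u ^ p\<close> over \<open>Re u = 1\<close>.\<close>

lemma riesz_mean_tendsto:
  assumes freq: "frequency lam" and hol: "f holomorphic_on {s. 0 < Re s}"
    and bound: "\<And>s. 0 < Re s \<Longrightarrow> cmod (f s) \<le> B * (1 + cmod s) ^ N" and w: "0 < Re w"
    and perron: "\<And>y. 0 < y \<Longrightarrow> bromwich (N + 2) (\<lambda>s. f (s + w)) y (1 / y)
       = bromwich (N + 2) (\<lambda>_. 1) 1 1 * riesz_sum lam (\<lambda>n. a n * exp (- of_real (lam n) * w)) (N + 1) y"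
  shows "((\<lambda>x. riesz_mean lam a (real (N + 1)) x w) \<longlongrightarrow> f w) at_top"
proof -
  let ?C = "bromwich (N + 2) (\<lambda>_. 1) 1 1"
  have C: "?C \<noteq> 0"
    by (rule bromwich_const_neq_0) simp
  have "0 \<le> B * (1 + cmod w) ^ N"
    using bound[OF w] norm_ge_zero order_trans by blast
  moreover have "0 < (1 + cmod w) ^ N"
    by (simp add: add_pos_nonneg)
  ultimately have B: "0 \<le> B"
    by (simp add: zero_le_mult_iff)
  \<comment> \<open>Replacing \<open>x\<close> by \<open>max 1 x\<close> changes nothing for
    \<open>x \<ge> 1\<close> and keeps the rescaled point at modulus at most
    \<open>cmod (Complex 1 t)\<close>, so that the domination holds for every real
    \<open>x\<close>.\<close>
  define G where "G x t = f (Complex 1 t / of_real (max 1 x) + w) * exp (of_real 1 * Complex 1 t) / Complex 1 t ^ (N + 2)" for x t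
  have G: "riesz_mean lam a (real (N + 1)) x w = (LINT t|lborel. G x t) / ?C" if "1 \<le> x" for x
  proof -
    have "?C * (of_real x ^ (N + 1) * riesz_mean lam a (real (N + 1)) x w) = bromwich (N + 2) (\<lambda>s. f (s + w)) x (1 / x)"
      using that by (simp only: riesz_mean_nat[OF freq] perron riesz_sum_def)
    also have "\<dots> = of_real x ^ (N + 1) * bromwich (N + 2) (\<lambda>s. f (s / of_real x + w)) 1 1"
      using bromwich_rescale[of x "N + 2" "\<lambda>s. f (s + w)"] that by simp
    also have "bromwich (N + 2) (\<lambda>s. f (s / of_real x + w)) 1 1 = (LINT t|lborel. G x t)"
      unfolding bromwich_def G_def max_absorb2[OF that] ..
    finally show ?thesis
      using that C by (simp add: nonzero_eq_divide_eq mult_ac)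
  qed
  let ?B = "B * (1 + cmod w) ^ N"
  have hol': "(\<lambda>s. f (s / of_real (max 1 x) + w)) holomorphic_on {s. 0 < Re s}" for x
  proof (rule holomorphic_on_compose_gen[OF _ hol, unfolded o_def])
    show "(\<lambda>s. s / of_real (max 1 x) + w) holomorphic_on {s. 0 < Re s}"
      by (intro holomorphic_intros) auto
    have "0 < Re s / max 1 x + Re w" if "0 < Re s" for s
      using that w by (intro add_pos_pos divide_pos_pos) auto
    then show "(\<lambda>s. s / of_real (max 1 x) + w) ` {s. 0 < Re s} \<subseteq> {s. 0 < Re s}"
      by auto
  qed
  have "((\<lambda>x. LINT t|lborel. G x t) \<longlongrightarrow> (LINT t|lborel. f w * (1 * exp (of_real 1 * Complex 1 t) / Complex 1 t ^ (N + 2)))) at_top"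
  proof (rule integral_dominated_convergence_at_top[where w = "\<lambda>t. ?B * (1 + 1 / 1) ^ (N + 2) * exp (1 * 1) / (1 + t\<^sup>2)"])
    show "(\<lambda>t. f w * (1 * exp (of_real 1 * Complex 1 t) / Complex 1 t ^ (N + 2))) \<in> borel_measurable lborel"
      using bromwich_integrand_measurable[of "\<lambda>_. 1" 0 1 1 "N + 2"] by (intro borel_measurable_times) auto
    show "G x \<in> borel_measurable lborel" for x
      unfolding G_def by (rule bromwich_integrand_measurable[OF hol']) auto
    show "\<forall>\<^sub>F x in at_top. AE t in lborel. norm (G x t) \<le> ?B * (1 + 1 / 1) ^ (N + 2) * exp (1 * 1) / (1 + t\<^sup>2)"
    proof (intro always_eventually allI AE_I2)
      fix x t :: real
      let ?s = "Complex 1 t"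
      have "cmod (?s / of_real (max 1 x)) \<le> cmod ?s"
        by (simp add: norm_divide divide_le_eq mult_left_le_one_le add_pos_nonneg mult_le_cancel_left1)
      then have "cmod (?s / of_real (max 1 x) + w) \<le> cmod ?s + cmod w"
        by (intro order_trans[OF norm_triangle_ineq] add_mono) auto
      then have "1 + cmod (?s / of_real (max 1 x) + w) \<le> (1 + cmod w) * (1 + cmod ?s)"
        using mult_nonneg_nonneg[OF norm_ge_zero[of w] norm_ge_zero[of ?s]]
        unfolding ring_distribs mult_1 mult_1_right by linarith
      then have "(1 + cmod (?s / of_real (max 1 x) + w)) ^ N \<le> (1 + cmod w) ^ N * (1 + cmod ?s) ^ N"
        unfolding power_mult_distrib[symmetric] by (intro power_mono) auto
      then have "B * (1 + cmod (?s / of_real (max 1 x) + w)) ^ N \<le> ?B * (1 + cmod ?s) ^ N"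
        using mult_left_mono[OF _ B] by (simp only: mult.assoc)
      moreover have "0 < Re (?s / of_real (max 1 x) + w)"
        using w by (simp add: add_pos_pos)
      ultimately have "cmod (f (?s / of_real (max 1 x) + w)) \<le> ?B * (1 + cmod ?s) ^ N"
        using bound order_trans by blast
      then show "norm (G x t) \<le> ?B * (1 + 1 / 1) ^ (N + 2) * exp (1 * 1) / (1 + t\<^sup>2)"
        using bromwich_kernel_bound[of 1 ?s N "N + 2" "\<lambda>s. f (s / of_real (max 1 x) + w)" ?B 1]
        by (simp add: G_def)
    qed
    show "AE t in lborel. ((\<lambda>x. G x t) \<longlongrightarrow> f w * (1 * exp (of_real 1 * Complex 1 t) / Complex 1 t ^ (N + 2))) at_top"
    proof (rule AE_I2)
      fix t :: real
      have nz: "Complex 1 t ^ (N + 2) \<noteq> 0" by (intro power_not_zero) (simp add: complex_eq_iff)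
      have "filterlim (\<lambda>x::real. max 1 x) at_top at_top"
        by (rule filterlim_at_top_mono[OF filterlim_ident]) simp
      then have "((\<lambda>x. Complex 1 t / of_real (max 1 x)) \<longlongrightarrow> 0) at_top"
        by (intro tendsto_divide_0[OF tendsto_const] filterlim_compose[OF filterlim_of_real_at_infinity])
      then have "((\<lambda>x. Complex 1 t / of_real (max 1 x) + w) \<longlongrightarrow> 0 + w) at_top"
        by (intro tendsto_intros)
      moreover have "isCont f (0 + w)"
        using hol w by (auto intro!: continuous_on_interior[OF holomorphic_on_imp_continuous_on]
            simp: interior_open open_halfspace_Re_gt)
      ultimately have "((\<lambda>x. f (Complex 1 t / of_real (max 1 x) + w)) \<longlongrightarrow> f (0 + w)) at_top"
        by (rule isCont_tendsto_compose[rotated])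
      then have "((\<lambda>x. G x t) \<longlongrightarrow> f (0 + w) * exp (of_real 1 * Complex 1 t) / Complex 1 t ^ (N + 2)) at_top"
        unfolding G_def by (intro tendsto_intros nz)
      then show "((\<lambda>x. G x t) \<longlongrightarrow> f w * (1 * exp (of_real 1 * Complex 1 t) / Complex 1 t ^ (N + 2))) at_top"
        by simp
    qed
  qed (rule integrable_Cauchy_density)
  then have "((\<lambda>x. (LINT t|lborel. G x t) / ?C) \<longlongrightarrow> f w * ?C / ?C) at_top"
    unfolding integral_mult_right_zero bromwich_def by (rule tendsto_divide[OF _ tendsto_const C[unfolded bromwich_def]])
  then have "((\<lambda>x. (LINT t|lborel. G x t) / ?C) \<longlongrightarrow> f w) at_top"
    using C by simp
  moreover have "\<forall>\<^sub>F x in at_top. (LINT t|lborel. G x t) / ?C = riesz_mean lam a (real (N + 1)) x w"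
    using eventually_ge_at_top[of 1] by eventually_elim (rule G[symmetric])
  ultimately show ?thesis
    by (rule Lim_transform_eventually)
qed

text \<open>The twisted Riesz mean at \<open>s\<close> is the original one at \<open>s + w\<close>;
  since \<open>Re w \<ge> 0\<close>, the same \<open>m\<close> and \<open>\<sigma>\<close>
  serve.\<close>

lemma riesz_germ_translate:
  assumes "riesz_germ lam a f" "0 \<le> Re w"
  shows "riesz_germ lam (\<lambda>n. a n * exp (- of_real (lam n) * w)) (\<lambda>s. f (s + w))"
proof -
  have "riesz_mean lam (\<lambda>n. a n * exp (- of_real (lam n) * w)) m x s = riesz_mean lam a m x (s + w)" for m x s
    unfolding riesz_mean_def
    by (intro sum.cong refl) (simp add: algebra_simps exp_diff exp_add exp_minus divide_inverse)
  then show ?thesis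
    using assms unfolding riesz_germ_def right_half_plane_def by fastforce
qed

subsection \<open>The normed space and its completeness\<close>

lemma one_plus_norm_powr_pos: "0 < (1 + norm s) powr l"
  using add_pos_nonneg[OF zero_less_one norm_ge_zero[of s]] by simp

lemma Hinf_bound:
  assumes "f \<in> Hinf lam l" "0 < Re s"
  shows "cmod (f s) \<le> Hinf_norm l f * (1 + cmod s) powr l"
proof -
  have "cmod (f s) / (1 + cmod s) powr l \<le> Hinf_norm l f"
    unfolding Hinf_norm_def using assms by (intro cSUP_upper) (auto simp: Hinf_def right_half_plane_def)
  moreover have "0 < (1 + cmod s) powr l"
    by (rule one_plus_norm_powr_pos)
  ultimately show ?thesis
    by (simp only: pos_divide_le_eq)
qed

lemma Hinf_norm_le:
  assumes "\<And>s. 0 < Re s \<Longrightarrow> cmod (f s) \<le> K * (1 + cmod s) powr l"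
  shows "Hinf_norm l f \<le> K"
  unfolding Hinf_norm_def
proof (rule cSUP_least)
  have "1 \<in> right_half_plane 0"
    by (simp add: right_half_plane_def)
  then show "right_half_plane 0 \<noteq> {}" by blast
  fix s assume "s \<in> right_half_plane 0"
  moreover have "0 < (1 + cmod s) powr l"
    by (rule one_plus_norm_powr_pos)
  ultimately show "cmod (f s) / (1 + cmod s) powr l \<le> K"
    using assms[of s] by (simp add: right_half_plane_def pos_divide_le_eq)
qed

lemma HinfI:
  assumes "f holomorphic_on {s. 0 < Re s}" "\<And>s. Re s \<le> 0 \<Longrightarrow> f s = 0" "riesz_germ lam a f"
    and bound: "\<And>s. 0 < Re s \<Longrightarrow> cmod (f s) \<le> K * (1 + cmod s) powr l"
  shows "f \<in> Hinf lam l"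
proof -
  have "bdd_above ((\<lambda>s. cmod (f s) / (1 + cmod s) powr l) ` right_half_plane 0)"
  proof (rule bdd_aboveI2)
    fix s assume "s \<in> right_half_plane 0"
    moreover have "0 < (1 + cmod s) powr l"
      by (rule one_plus_norm_powr_pos)
    ultimately show "cmod (f s) / (1 + cmod s) powr l \<le> K"
      using bound[of s] by (simp add: right_half_plane_def pos_divide_le_eq)
  qed
  then show ?thesis
    using assms by (auto simp: Hinf_def right_half_plane_def)
qed

lemma HinfD:
  assumes "f \<in> Hinf lam l"
  shows "f holomorphic_on {s. 0 < Re s}" "\<And>s. Re s \<le> 0 \<Longrightarrow> f s = 0" "\<exists>a. riesz_germ lam a f"
  using assms unfolding Hinf_def right_half_plane_def by (simp_all add: not_less)

lemma Hinf_norm_nonneg: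
  assumes "f \<in> Hinf lam l"
  shows "0 \<le> Hinf_norm l f"
proof -
  have "cmod (f 1) \<le> Hinf_norm l f * (1 + cmod 1) powr l"
    by (rule Hinf_bound[OF assms]) simp
  then have "0 \<le> Hinf_norm l f * (1 + cmod 1) powr l"
    by (rule order_trans[OF norm_ge_zero])
  then show ?thesis
    by (simp add: zero_le_mult_iff)
qed

lemma powr_le_power_nat_ceiling:
  fixes x :: real
  assumes "1 \<le> x"
  shows "x powr l \<le> x ^ nat \<lceil>l\<rceil>"
proof -
  have "x powr l \<le> x powr real (nat \<lceil>l\<rceil>)"
    using assms by (intro powr_mono) linarith+
  then show ?thesis
    using assms by (simp add: powr_realpow)
qed

lemma one_plus_norm_shift_power:
  "(1 + cmod (s + w)) ^ N \<le> (1 + cmod w) ^ N * (1 + cmod s) ^ N"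
proof -
  have "1 + cmod (s + w) \<le> (1 + cmod w) * (1 + cmod s)"
    using norm_triangle_ineq[of s w] mult_nonneg_nonneg[OF norm_ge_zero[of w] norm_ge_zero[of s]]
    unfolding ring_distribs mult_1 mult_1_right by linarith
  then show ?thesis
    unfolding power_mult_distrib[symmetric] by (intro power_mono) auto
qed

text \<open>The translate grows with the same exponent because \<open>1 + cmod (s + w)\<close> is at
  most \<open>(1 + cmod w) * (1 + cmod s)\<close>. Rounding \<open>l\<close> up provides the integer
  exponent of Perron's formula.\<close>

lemma growth_translate:
  assumes "\<And>s. 0 < Re s \<Longrightarrow> cmod (f s) \<le> B * (1 + cmod s) powr l"
    and "0 \<le> B" "0 \<le> Re w" "0 < Re s"
  shows "cmod (f (s + w)) \<le> B * (1 + cmod w) ^ nat \<lceil>l\<rceil> * (1 + cmod s) ^ nat \<lceil>l\<rceil>"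
proof -
  have "cmod (f (s + w)) \<le> B * (1 + cmod (s + w)) powr l"
    using assms by simp
  also have "\<dots> \<le> B * ((1 + cmod w) ^ nat \<lceil>l\<rceil> * (1 + cmod s) ^ nat \<lceil>l\<rceil>)"
    using order_trans[OF powr_le_power_nat_ceiling one_plus_norm_shift_power] assms(2)
    by (intro mult_left_mono) auto
  finally show ?thesis by (simp only: mult.assoc)
qed

lemma holomorphic_translate:
  assumes "f holomorphic_on {s. 0 < Re s}" "0 \<le> Re w"
  shows "(\<lambda>s. f (s + w)) holomorphic_on {s. 0 < Re s}"
  by (rule holomorphic_on_compose_gen[OF _ assms(1), unfolded o_def])
     (use assms(2) in \<open>auto intro!: holomorphic_intros\<close>)

section \<open>The linear structure of \<open>Hinf\<close>\<close>

lemma Hinf_perron: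
  assumes freq: "frequency lam" and f: "f \<in> Hinf lam l" "riesz_germ lam a f" and "0 \<le> Re w" "0 < c"
  shows "bromwich (nat \<lceil>l\<rceil> + 2) (\<lambda>s. f (s + w)) y c = bromwich (nat \<lceil>l\<rceil> + 2) (\<lambda>_. 1) 1 1
    * riesz_sum lam (\<lambda>n. a n * exp (- of_real (lam n) * w)) (nat \<lceil>l\<rceil> + 1) y"
  by (rule perron_formula[OF freq holomorphic_translate[OF HinfD(1)[OF f(1)] assms(4)]
        growth_translate[OF Hinf_bound[OF f(1)] Hinf_norm_nonneg[OF f(1)] assms(4)]
        riesz_germ_translate[OF f(2) assms(4)] assms(5)])

lemma riesz_mean_tendsto_of_growth:
  assumes freq: "frequency lam" and hol: "f holomorphic_on {s. 0 < Re s}"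
    and bound: "\<And>s. 0 < Re s \<Longrightarrow> cmod (f s) \<le> B * (1 + cmod s) powr l" and "0 \<le> B" and w: "0 < Re w"
    and perron: "\<And>y. 0 < y \<Longrightarrow> bromwich (nat \<lceil>l\<rceil> + 2) (\<lambda>s. f (s + w)) y (1 / y)
       = bromwich (nat \<lceil>l\<rceil> + 2) (\<lambda>_. 1) 1 1 * riesz_sum lam (\<lambda>n. a n * exp (- of_real (lam n) * w)) (nat \<lceil>l\<rceil> + 1) y"
  shows "((\<lambda>x. riesz_mean lam a (real (nat \<lceil>l\<rceil> + 1)) x w) \<longlongrightarrow> f w) at_top"
  by (rule riesz_mean_tendsto[OF freq hol _ w perron, where B = B])
     (use growth_translate[of f B l 0, OF bound \<open>0 \<le> B\<close>] in simp)

text \<open>Through Perron's formula, convergence at some order on some half plane becomes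
  convergence at an order that depends on \<open>l\<close> alone, and on all of
  \<open>Re w > 0\<close>. Two germs thereby share an order and can be added term by term.\<close>

lemma Hinf_riesz_mean_tendsto:
  assumes "frequency lam" "f \<in> Hinf lam l" "riesz_germ lam a f" "0 < Re w"
  shows "((\<lambda>x. riesz_mean lam a (real (nat \<lceil>l\<rceil> + 1)) x w) \<longlongrightarrow> f w) at_top"
  by (rule riesz_mean_tendsto_of_growth[OF assms(1) HinfD(1)[OF assms(2)] Hinf_bound[OF assms(2)]
        Hinf_norm_nonneg[OF assms(2)] assms(4)])
     (use Hinf_perron[OF assms(1-3)] assms(4) in auto)

lemma riesz_germI:
  assumes "0 \<le> m" "\<And>s. 0 < Re s \<Longrightarrow> ((\<lambda>x. riesz_mean lam a m x s) \<longlongrightarrow> f s) at_top"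
  shows "riesz_germ lam a f"
  unfolding riesz_germ_def right_half_plane_def using assms by (intro exI[of _ m] exI[of _ 0] conjI) auto

lemma Hinf_zero: "0 \<in> Hinf lam l"
proof (rule HinfI[where a = "\<lambda>_. 0" and K = 0])
  show "riesz_germ lam (\<lambda>_. 0) 0"
    by (rule riesz_germI[of 0]) (simp_all add: riesz_mean_def)
qed (auto simp: zero_fun_def)

lemma Hinf_scale:
  assumes "f \<in> Hinf lam l"
  shows "fun_scale c f \<in> Hinf lam l"
proof -
  obtain a where "riesz_germ lam a f"
    using HinfD(3)[OF assms] by blast
  then obtain m \<sigma> where m: "0 \<le> m" "0 \<le> \<sigma>"
    and lim: "\<And>s. s \<in> right_half_plane \<sigma> \<Longrightarrow> ((\<lambda>x. riesz_mean lam a m x s) \<longlongrightarrow> f s) at_top"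
    by (auto simp: riesz_germ_def)
  have "riesz_mean lam (\<lambda>n. c * a n) m x s = c * riesz_mean lam a m x s" for x s
    by (simp add: riesz_mean_def sum_distrib_left mult.assoc)
  then have "riesz_germ lam (\<lambda>n. c * a n) (fun_scale c f)"
    unfolding riesz_germ_def fun_scale_def using m lim
    by (intro exI[of _ m] exI[of _ \<sigma>] conjI ballI) (auto intro: tendsto_mult_left)
  then show ?thesis
  proof (rule HinfI[rotated 2])
    show "cmod (fun_scale c f s) \<le> (cmod c * Hinf_norm l f) * (1 + cmod s) powr l" if "0 < Re s" for s
      using Hinf_bound[OF assms that] by (simp add: fun_scale_def norm_mult mult.assoc mult_left_mono)
  qed (use HinfD[OF assms] in \<open>auto simp: fun_scale_def intro!: holomorphic_intros\<close>)
qed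

lemma Hinf_norm_triangle_bound:
  assumes "f \<in> Hinf lam l" "g \<in> Hinf lam l" "0 < Re s"
  shows "cmod ((f + g) s) \<le> (Hinf_norm l f + Hinf_norm l g) * (1 + cmod s) powr l"
  using norm_triangle_ineq[of "f s" "g s"] Hinf_bound[OF assms(1,3)] Hinf_bound[OF assms(2,3)]
  unfolding plus_fun_apply distrib_right by linarith

lemma Hinf_add:
  assumes freq: "frequency lam" and f: "f \<in> Hinf lam l" and g: "g \<in> Hinf lam l"
  shows "f + g \<in> Hinf lam l"
proof -
  obtain a b where a: "riesz_germ lam a f" and b: "riesz_germ lam b g"
    using HinfD(3)[OF f] HinfD(3)[OF g] by blast
  have "riesz_mean lam (\<lambda>n. a n + b n) m x s = riesz_mean lam a m x s + riesz_mean lam b m x s" for m x s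
    by (simp add: riesz_mean_def sum.distrib distrib_right)
  then have "riesz_germ lam (\<lambda>n. a n + b n) (f + g)"
    using Hinf_riesz_mean_tendsto[OF freq f a] Hinf_riesz_mean_tendsto[OF freq g b]
    by (intro riesz_germI[of "real (nat \<lceil>l\<rceil> + 1)"]) (auto intro: tendsto_add)
  then show ?thesis
  proof (rule HinfI[rotated 2])
    show "f + g holomorphic_on {s. 0 < Re s}"
      unfolding plus_fun_def by (intro holomorphic_intros HinfD(1)[OF f] HinfD(1)[OF g])
    show "(f + g) s = 0" if "Re s \<le> 0" for s
      using HinfD(2)[OF f that] HinfD(2)[OF g that] by simp
  qed (rule Hinf_norm_triangle_bound[OF f g])
qed

lemma Hinf_norm_eq_0_iff:
  assumes "f \<in> Hinf lam l"
  shows "Hinf_norm l f = 0 \<longleftrightarrow> f = 0"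
proof
  assume 0: "Hinf_norm l f = 0"
  have "f s = 0" for s
  proof (cases "0 < Re s")
    case True
    then show ?thesis
      using Hinf_bound[OF assms True] 0 by simp
  qed (use HinfD(2)[OF assms] in auto)
  then show "f = 0" by (simp add: fun_eq_iff)
next
  assume "f = 0"
  then have "Hinf_norm l f \<le> 0"
    by (intro Hinf_norm_le) simp
  then show "Hinf_norm l f = 0"
    using Hinf_norm_nonneg[OF assms] by simp
qed

text \<open>For \<open>c \<noteq> 0\<close>, the upper bound applied to the factor
  \<open>inverse c\<close> and the function \<open>fun_scale c f\<close> is the missing lower
  bound.\<close>

lemma Hinf_norm_scale:
  assumes "f \<in> Hinf lam l"
  shows "Hinf_norm l (fun_scale c f) = cmod c * Hinf_norm l f"
proof -
  have le: "Hinf_norm l (fun_scale c f) \<le> cmod c * Hinf_norm l f" if "f \<in> Hinf lam l" for c f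
    by (rule Hinf_norm_le)
       (use Hinf_bound[OF that] in \<open>simp add: fun_scale_def norm_mult mult.assoc mult_left_mono\<close>)
  show ?thesis
  proof (cases "c = 0")
    case True
    then have "fun_scale c f = 0"
      by (simp add: fun_scale_def fun_eq_iff)
    then show ?thesis
      using True Hinf_norm_eq_0_iff[OF Hinf_zero] by simp
  next
    case False
    have "fun_scale (inverse c) (fun_scale c f) = f"
      using False by (simp add: fun_scale_def fun_eq_iff)
    then have "Hinf_norm l f \<le> cmod (inverse c) * Hinf_norm l (fun_scale c f)"
      using le[OF Hinf_scale[OF assms], of "inverse c" c] by simp
    then have "cmod c * Hinf_norm l f \<le> cmod c * (cmod (inverse c) * Hinf_norm l (fun_scale c f))"
      by (rule mult_left_mono) simp
    also have "\<dots> = Hinf_norm l (fun_scale c f)"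
      using False by (simp add: norm_inverse)
    finally show ?thesis
      using le[OF assms, of c] by simp
  qed
qed

lemma Hinf_complex_normed_space:
  assumes freq: "frequency lam"
  shows "complex_normed_space_on fun_scale (Hinf lam l) (Hinf_norm l)"
proof -
  interpret vector_space fun_scale
    by unfold_locales (auto simp: fun_scale_def fun_eq_iff algebra_simps)
  show ?thesis
  proof
    show "subspace (Hinf lam l)"
      unfolding subspace_def using Hinf_zero Hinf_add[OF freq] Hinf_scale by blast
    show "Hinf_norm l (f + g) \<le> Hinf_norm l f + Hinf_norm l g" if "f \<in> Hinf lam l" "g \<in> Hinf lam l" for f g
      by (rule Hinf_norm_le) (rule Hinf_norm_triangle_bound[OF that])
  qed (simp_all add: Hinf_norm_nonneg Hinf_norm_eq_0_iff Hinf_norm_scale)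
qed

section \<open>Completeness\<close>

text \<open>The coefficients are read off from the values of the Riesz sums at the points of the
  frequency, where the system is triangular.\<close>

lemma riesz_sum_coefficients_convergent:
  assumes freq: "frequency lam" and conv: "\<And>y. convergent (\<lambda>j. riesz_sum lam (A j) k y)"
  shows "convergent (\<lambda>j. A j n)"
proof (induction n rule: less_induct)
  case (less n)
  \<comment> \<open>With the strict condition \<open>lam i < y\<close>, the choice
    \<open>lam (Suc n)\<close> selects exactly the indices up to \<open>n\<close>, and the
    coefficient of \<open>A j n\<close> is a power of
    \<open>lam (Suc n) - lam n > 0\<close>.\<close>
  define y where "y = lam (Suc n)"
  have lt: "lam i < lam j \<longleftrightarrow> i < j" for i j
    using freq strict_mono_less by (auto simp: frequency_def)
  have "{i. lam i < y} = insert n {..<n}"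
    by (auto simp: y_def lt)
  then have "riesz_sum lam (A j) k y = A j n * of_real (y - lam n) ^ k + (\<Sum>i<n. A j i * of_real (y - lam i) ^ k)" for j
    by (simp add: riesz_sum_def)
  then have eq: "A j n = (riesz_sum lam (A j) k y - (\<Sum>i<n. A j i * of_real (y - lam i) ^ k)) / of_real (y - lam n) ^ k" for j
    using lt[of n "Suc n"] by (simp add: y_def)
  obtain L where L: "\<And>i. i < n \<Longrightarrow> (\<lambda>j. A j i) \<longlonglongrightarrow> L i"
    using less unfolding convergent_def by metis
  obtain R where "(\<lambda>j. riesz_sum lam (A j) k y) \<longlonglongrightarrow> R"
    using conv unfolding convergent_def by blast
  then have "(\<lambda>j. (riesz_sum lam (A j) k y - (\<Sum>i<n. A j i * of_real (y - lam i) ^ k)) / of_real (y - lam n) ^ k)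
      \<longlonglongrightarrow> (R - (\<Sum>i<n. L i * of_real (y - lam i) ^ k)) / of_real (y - lam n) ^ k"
    using lt[of n "Suc n"] by (intro tendsto_intros L) (auto simp: y_def)
  then show ?case
    unfolding eq[symmetric] convergent_def by blast
qed

lemma Hinf_complete:
  fixes F :: "nat \<Rightarrow> complex \<Rightarrow> complex"
  assumes freq: "frequency lam" and F: "\<And>n. F n \<in> Hinf lam l"
    and Cauchy: "\<And>\<epsilon>. 0 < \<epsilon> \<Longrightarrow> \<exists>N. \<forall>m\<ge>N. \<forall>n\<ge>N. Hinf_norm l (F m - F n) < \<epsilon>"
  shows "\<exists>f\<in>Hinf lam l. \<forall>\<epsilon>>0. \<exists>N. \<forall>n\<ge>N. Hinf_norm l (F n - f) < \<epsilon>"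
proof -
  interpret complex_normed_space_on fun_scale "Hinf lam l" "Hinf_norm l"
    by (rule Hinf_complex_normed_space[OF freq])
  let ?w = "\<lambda>s. (1 + cmod s) powr l"
  have w: "0 < ?w s" for s
    by (rule one_plus_norm_powr_pos)
  have diff: "cmod (F m s - F n s) \<le> Hinf_norm l (F m - F n) * ?w s" if "0 < Re s" for m n s
    using Hinf_bound[OF diff_in_V[OF F F] that, of m n] by simp
  \<comment> \<open>Outside the half plane all \<open>F n\<close> vanish, so the pointwise limit is
    extended by \<open>0\<close> as well.\<close>
  define f where "f s = lim (\<lambda>n. F n s)" for s
  have lim: "(\<lambda>n. F n s) \<longlonglongrightarrow> f s" for s
  proof (cases "0 < Re s")
    case True
    have "Cauchy (\<lambda>n. F n s)"
    proof (rule CauchyI)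
      fix e :: real assume "0 < e"
      then obtain N where N: "\<And>m n. m \<ge> N \<Longrightarrow> n \<ge> N \<Longrightarrow> Hinf_norm l (F m - F n) < e / ?w s"
        using Cauchy[of "e / ?w s"] w by (metis divide_pos_pos)
      have "norm (F m s - F n s) < e" if "m \<ge> N" "n \<ge> N" for m n
      proof -
        have "Hinf_norm l (F m - F n) * ?w s < e"
          using N[OF that] w[of s] by (simp only: pos_less_divide_eq)
        then show ?thesis
          using diff[OF True, of m n] by linarith
      qed
      then show "\<exists>N. \<forall>m\<ge>N. \<forall>n\<ge>N. norm (F m s - F n s) < e" by blast
    qed
    then show ?thesis
      unfolding f_def by (simp add: Cauchy_convergent_iff convergent_LIMSEQ_iff)
  next
    case False
    then show ?thesis
      using HinfD(2)[OF F] by (simp add: f_def lim_def[symmetric] not_less)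
  qed
  have close: "\<exists>N. \<forall>n\<ge>N. \<forall>s. 0 < Re s \<longrightarrow> cmod (F n s - f s) \<le> \<epsilon> * ?w s" if "0 < \<epsilon>" for \<epsilon>
  proof -
    obtain N where N: "\<And>m n. m \<ge> N \<Longrightarrow> n \<ge> N \<Longrightarrow> Hinf_norm l (F m - F n) < \<epsilon>"
      using Cauchy[OF \<open>0 < \<epsilon>\<close>] by blast
    have "cmod (F n s - f s) \<le> \<epsilon> * ?w s" if "n \<ge> N" "0 < Re s" for n s
    proof (rule LIMSEQ_le_const2)
      show "(\<lambda>m. cmod (F n s - F m s)) \<longlonglongrightarrow> cmod (F n s - f s)"
        by (intro tendsto_intros lim)
      have "cmod (F n s - F m s) \<le> \<epsilon> * ?w s" if "m \<ge> N" for m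
      proof -
        have "Hinf_norm l (F n - F m) * ?w s \<le> \<epsilon> * ?w s"
          using N[OF \<open>n \<ge> N\<close> that] w[of s] by (intro mult_right_mono) auto
        then show ?thesis
          using diff[OF \<open>0 < Re s\<close>, of n m] by linarith
      qed
      then show "\<exists>M. \<forall>m\<ge>M. cmod (F n s - F m s) \<le> \<epsilon> * ?w s" by blast
    qed
    then show ?thesis by blast
  qed
  obtain N0 where N0: "\<And>n s. n \<ge> N0 \<Longrightarrow> 0 < Re s \<Longrightarrow> cmod (F n s - f s) \<le> 1 * ?w s"
    using close[OF zero_less_one] by blast
  \<comment> \<open>The limit \<open>f\<close> is within one weight of \<open>F N0\<close>, and each
    later \<open>F n\<close> within one weight of \<open>f\<close>; adding \<open>2\<close> gives a
    single bound for \<open>f\<close> and the whole tail.\<close>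
  define B where "B = Hinf_norm l (F N0) + 2"
  have "0 \<le> B"
    using Hinf_norm_nonneg[OF F, of N0] by (simp add: B_def)
  have fN0: "cmod (f s) \<le> (Hinf_norm l (F N0) + 1) * ?w s" if "0 < Re s" for s
    using norm_triangle_sub[of "f s" "F N0 s"] N0[OF order_refl that] Hinf_bound[OF F that, of N0]
    unfolding distrib_right norm_minus_commute[of "f s" "F N0 s"] by linarith
  have FB: "cmod (F n s) \<le> B * ?w s" if "n \<ge> N0" "0 < Re s" for n s
    using norm_triangle_sub[of "F n s" "f s"] N0[OF that] fN0[OF that(2)]
    unfolding B_def distrib_right by linarith
  have fB: "cmod (f s) \<le> B * ?w s" if "0 < Re s" for s
    using fN0[OF that] w[of s] unfolding B_def distrib_right by linarith
  have hol: "f holomorphic_on {s. 0 < Re s}"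
  proof (rule holomorphic_uniform_sequence[where f = F])
    show "open {s. 0 < Re s}" by (rule open_halfspace_Re_gt)
    show "F n holomorphic_on {s. 0 < Re s}" for n by (rule HinfD(1)[OF F])
    fix x assume x: "x \<in> {s. 0 < Re s}"
    \<comment> \<open>The radius keeps the ball inside the half plane. On it the weight is bounded
      by the constant \<open>K\<close> below, so convergence in the norm is uniform there.\<close>
    define d where "d = Re x / 2"
    have "0 < d" using x by (simp add: d_def)
    have sub: "cball x d \<subseteq> {s. 0 < Re s}"
    proof
      fix s assume "s \<in> cball x d"
      then have "\<bar>Re x - Re s\<bar> \<le> d"
        using abs_Re_le_cmod[of "x - s"] by (simp add: dist_norm)
      moreover have "Re x = 2 * d"
        by (simp add: d_def)
      ultimately show "s \<in> {s. 0 < Re s}"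
        using \<open>0 < d\<close> unfolding mem_Collect_eq by linarith
    qed
    define K where "K = (1 + cmod x + d) ^ nat \<lceil>l\<rceil>"
    have "0 < K" using \<open>0 < d\<close> by (simp add: K_def add_pos_nonneg)
    have wK: "?w s \<le> K" if "s \<in> cball x d" for s
    proof -
      have "cmod s \<le> cmod x + d"
        using that norm_triangle_sub[of s x] by (simp add: dist_norm norm_minus_commute)
      then have "(1 + cmod s) ^ nat \<lceil>l\<rceil> \<le> K"
        unfolding K_def by (intro power_mono) auto
      then show ?thesis
        using powr_le_power_nat_ceiling[of "1 + cmod s" l] by simp
    qed
    have "uniform_limit (cball x d) F f sequentially"
    proof (rule uniform_limitI)
      fix e :: real assume "0 < e"
      then have "0 < e / (2 * K)" using \<open>0 < K\<close> by simp
      from close[OF this] obtain N where N: "\<And>n s. n \<ge> N \<Longrightarrow> 0 < Re s \<Longrightarrow> cmod (F n s - f s) \<le> e / (2 * K) * ?w s"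
        by blast
      have "dist (F n s) (f s) < e" if "n \<ge> N" "s \<in> cball x d" for n s
      proof -
        have "cmod (F n s - f s) \<le> e / (2 * K) * ?w s"
          using N[OF that(1)] sub that(2) by blast
        also have "\<dots> \<le> e / (2 * K) * K"
          using wK[OF that(2)] \<open>0 < e / (2 * K)\<close> by (intro mult_left_mono) auto
        also have "\<dots> < e"
          using \<open>0 < e\<close> \<open>0 < K\<close> by simp
        finally show ?thesis by (simp add: dist_norm)
      qed
      then show "\<forall>\<^sub>F n in sequentially. \<forall>s\<in>cball x d. dist (F n s) (f s) < e"
        unfolding eventually_sequentially by blast
    qed
    then show "\<exists>d>0. cball x d \<subseteq> {s. 0 < Re s} \<and> uniform_limit (cball x d) F f sequentially"
      using \<open>0 < d\<close> sub by blast
  qed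
  let ?N = "nat \<lceil>l\<rceil>"
  let ?C = "bromwich (?N + 2) (\<lambda>_. 1) 1 1"
  have C: "?C \<noteq> 0"
    by (rule bromwich_const_neq_0) simp
  obtain A where A: "\<And>j. riesz_germ lam (A j) (F j)"
    using HinfD(3)[OF F] by metis
  \<comment> \<open>The bound \<open>B\<close> is known from the index \<open>N0\<close> on, so the
    sequence is shifted before dominated convergence is applied.\<close>
  have brom: "(\<lambda>j. bromwich (?N + 2) (\<lambda>s. F j (s + w)) y c) \<longlonglongrightarrow> bromwich (?N + 2) (\<lambda>s. f (s + w)) y c"
    if w: "0 \<le> Re w" "0 < c" for w y c
  proof (rule LIMSEQ_offset[where k = N0], rule bromwich_tendsto[OF _ _ order_refl w(2)])
    show "(\<lambda>s. F (j + N0) (s + w)) holomorphic_on {s. 0 < Re s}" for j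
      by (rule holomorphic_translate[OF HinfD(1)[OF F] w(1)])
    show "(\<lambda>s. f (s + w)) holomorphic_on {s. 0 < Re s}"
      by (rule holomorphic_translate[OF hol w(1)])
    show "cmod (F (j + N0) (Complex c t + w)) \<le> B * (1 + cmod w) ^ ?N * (1 + cmod (Complex c t)) ^ ?N" for j t
      by (rule growth_translate[OF FB \<open>0 \<le> B\<close> w(1)]) (use w in auto)
    show "(\<lambda>j. F (j + N0) (Complex c t + w)) \<longlonglongrightarrow> f (Complex c t + w)" for t
      by (rule LIMSEQ_ignore_initial_segment[OF lim])
  qed simp
  have sums: "(\<lambda>j. riesz_sum lam (\<lambda>n. A j n * exp (- of_real (lam n) * w)) (?N + 1) y)
      \<longlonglongrightarrow> bromwich (?N + 2) (\<lambda>s. f (s + w)) y c / ?C" if w: "0 \<le> Re w" "0 < c" for w y c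
  proof -
    have "riesz_sum lam (\<lambda>n. A j n * exp (- of_real (lam n) * w)) (?N + 1) y
        = bromwich (?N + 2) (\<lambda>s. F j (s + w)) y c / ?C" for j
      unfolding Hinf_perron[OF freq F A w] by (rule nonzero_mult_div_cancel_left[OF C, symmetric])
    then show ?thesis
      using tendsto_divide[OF brom[OF w] tendsto_const C] by simp
  qed
  \<comment> \<open>The case \<open>w = 0\<close> of \<open>sums\<close> fixes the limit
    coefficients.\<close>
  have "convergent (\<lambda>j. A j n)" for n
  proof (rule riesz_sum_coefficients_convergent[OF freq])
    show "convergent (\<lambda>j. riesz_sum lam (A j) (?N + 1) y)" for y
      using sums[of 0 1 y] unfolding convergent_def by auto
  qed
  then obtain a where a: "\<And>n. (\<lambda>j. A j n) \<longlonglongrightarrow> a n"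
    unfolding convergent_def by metis
  \<comment> \<open>For fixed \<open>y\<close> a Riesz sum is finite, so the coefficient limits pass
    through it for every twist \<open>w\<close>. This gives Perron's formula for all translates of
    \<open>f\<close> with one and the same sequence \<open>a\<close>.\<close>
  have perron: "bromwich (?N + 2) (\<lambda>s. f (s + w)) y c
      = ?C * riesz_sum lam (\<lambda>n. a n * exp (- of_real (lam n) * w)) (?N + 1) y"
    if w: "0 \<le> Re w" "0 < c" for w y c
  proof -
    have "(\<lambda>j. riesz_sum lam (\<lambda>n. A j n * exp (- of_real (lam n) * w)) (?N + 1) y)
        \<longlonglongrightarrow> riesz_sum lam (\<lambda>n. a n * exp (- of_real (lam n) * w)) (?N + 1) y"
      unfolding riesz_sum_def by (intro tendsto_sum tendsto_mult tendsto_const a)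
    from LIMSEQ_unique[OF this sums[OF w]]
    have eq: "riesz_sum lam (\<lambda>n. a n * exp (- of_real (lam n) * w)) (?N + 1) y
        = bromwich (?N + 2) (\<lambda>s. f (s + w)) y c / ?C" .
    show ?thesis
      unfolding eq times_divide_eq_right by (rule nonzero_mult_div_cancel_left[OF C, symmetric])
  qed
  have germ: "riesz_germ lam a f"
  proof (rule riesz_germI[of "real (?N + 1)"])
    fix w :: complex assume "0 < Re w"
    then show "((\<lambda>x. riesz_mean lam a (real (?N + 1)) x w) \<longlongrightarrow> f w) at_top"
      by (intro riesz_mean_tendsto_of_growth[OF freq hol fB \<open>0 \<le> B\<close>] perron) simp_all
  qed simp
  have "f \<in> Hinf lam l"
  proof (rule HinfI[OF hol _ germ])
    show "f s = 0" if "Re s \<le> 0" for s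
      using lim[of s] HinfD(2)[OF F that] by (simp add: LIMSEQ_const_iff)
  qed (rule fB)
  moreover have "\<exists>N. \<forall>n\<ge>N. Hinf_norm l (F n - f) < \<epsilon>" if "0 < \<epsilon>" for \<epsilon>
  proof -
    \<comment> \<open>Passing to the supremum yields only \<open>\<le>\<close>; the halved bound
      restores strictness.\<close>
    have "0 < \<epsilon> / 2" using that by simp
    from close[OF this] obtain N where N: "\<And>n s. n \<ge> N \<Longrightarrow> 0 < Re s \<Longrightarrow> cmod (F n s - f s) \<le> \<epsilon> / 2 * ?w s"
      by blast
    have "Hinf_norm l (F n - f) \<le> \<epsilon> / 2" if "n \<ge> N" for n
      by (rule Hinf_norm_le) (use N[OF that] in simp)
    then have "\<forall>n\<ge>N. Hinf_norm l (F n - f) < \<epsilon>"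
      using \<open>0 < \<epsilon>\<close> by fastforce
    then show ?thesis by blast
  qed
  ultimately show ?thesis by blast
qed

theorem theorem3p16:
  fixes lam :: "nat \<Rightarrow> real" and l :: real
  assumes "frequency lam" and "l \<ge> 0"
  shows "complex_banach_space_on fun_scale (Hinf lam l) (Hinf_norm l)"
proof -
  interpret complex_normed_space_on fun_scale "Hinf lam l" "Hinf_norm l"
    by (rule Hinf_complex_normed_space[OF assms(1)])
  have "norm_metric.mcomplete"
    unfolding norm_metric.mcomplete_def
  proof (intro allI impI)
    fix F assume MC: "norm_metric.MCauchy F"
    \<comment> \<open>\<open>MCauchy\<close> includes that the range lies in the carrier, so
      \<open>norm_dist\<close> is here the norm of the difference and not its default value
      \<open>0\<close>.\<close>
    then have F: "F n \<in> Hinf lam l" for n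
      by (auto simp: norm_metric.MCauchy_def)
    have Cauchy: "\<exists>N. \<forall>m\<ge>N. \<forall>n\<ge>N. Hinf_norm l (F m - F n) < \<epsilon>" if "0 < \<epsilon>" for \<epsilon>
    proof -
      obtain N where N: "\<And>m n. N \<le> m \<Longrightarrow> N \<le> n \<Longrightarrow> norm_dist (F m) (F n) < \<epsilon>"
        using MC \<open>0 < \<epsilon>\<close> unfolding norm_metric.MCauchy_def by blast
      then show ?thesis
        using F by (auto simp: norm_dist_def)
    qed
    obtain f where f: "f \<in> Hinf lam l" "\<forall>\<epsilon>>0. \<exists>N. \<forall>n\<ge>N. Hinf_norm l (F n - f) < \<epsilon>"
      using Hinf_complete[where F = F, OF assms(1) F Cauchy] by blast
    then show "\<exists>f. limitin norm_metric.mtopology F f sequentially"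
      unfolding norm_metric.limit_metric_sequentially
      by (intro exI[of _ f]) (simp add: norm_dist_def F)
  qed
  then show ?thesis
    by unfold_locales
qed

end
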